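(* Let $q$ be even and $k\ge 1$. (i) An ${\rm Sp}(4k,q)$-space has a maximal symplectic partial spread of size $q^k+1$ that is also a maximal orthogonal partial spread (with respect to a quadratic form of plus type whose polar form is the given symplectic form). (ii) An ${\rm Sp}(4k,q)$-space has a maximal symplectic partial spread of size $2q^k+1$.
   Context: An ${\rm Sp}(2n,q)$-space is a $2n$-dimensional $\mathbb{F}_q$-space with a nondegenerate alternating form; totally isotropic (t.i.) subspaces are those on which the form vanishes. For a quadratic form $Q$, totally singular (t.s.) subspaces are those on which $Q$ vanishes. A symplectic (resp. orthogonal) partial spread is a set of t.i. (resp. t.s.) $n$-dimensional subspaces pairwise meeting only in $0$; it is maximal if not properly contained in another such partial spread. *)

theory Defs
  imports Complex_Main "HOL-Library.Cardinality"
begin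

definition polar_form :: "('b::ab_group_add \<Rightarrow> 'a::ab_group_add) \<Rightarrow> 'b \<Rightarrow> 'b \<Rightarrow> 'a" where
  "polar_form Q x y = Q (x + y) - Q x - Q y"

text \<open>For the reflexive forms considered here (alternating forms, and polar forms, which are
  symmetric) the left and the right radical coincide.\<close>

definition nondegenerate_form :: "('b::zero \<Rightarrow> 'b \<Rightarrow> 'a::zero) \<Rightarrow> bool" where
  "nondegenerate_form B \<longleftrightarrow> (\<forall>x. (\<forall>y. B x y = 0) \<longrightarrow> x = 0)"

text \<open>Finite dimension is required explicitly because \<^term>\<open>vector_space.dim\<close> is 0 on
  infinite-dimensional spaces.\<close>

locale fq_space = vector_space scale
  for scale :: "'a::{field,finite} \<Rightarrow> 'b::ab_group_add \<Rightarrow> 'b" +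
  assumes finite_span: "\<exists>X. finite X \<and> span X = UNIV"
begin

definition bilinear_form :: "('b \<Rightarrow> 'b \<Rightarrow> 'a) \<Rightarrow> bool" where
  "bilinear_form B \<longleftrightarrow>
     (\<forall>x. Vector_Spaces.linear scale (*) (\<lambda>y. B x y)) \<and>
     (\<forall>y. Vector_Spaces.linear scale (*) (\<lambda>x. B x y))"

definition alternating_form :: "('b \<Rightarrow> 'b \<Rightarrow> 'a) \<Rightarrow> bool" where
  "alternating_form B \<longleftrightarrow> bilinear_form B \<and> (\<forall>x. B x x = 0)"

definition quadratic_form :: "('b \<Rightarrow> 'a) \<Rightarrow> bool" where
  "quadratic_form Q \<longleftrightarrow>
     (\<forall>c x. Q (scale c x) = c\<^sup>2 * Q x) \<and> bilinear_form (polar_form Q)"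

definition totally_isotropic :: "('b \<Rightarrow> 'b \<Rightarrow> 'a) \<Rightarrow> 'b set \<Rightarrow> bool" where
  "totally_isotropic B W \<longleftrightarrow> subspace W \<and> (\<forall>x\<in>W. \<forall>y\<in>W. B x y = 0)"

definition totally_singular :: "('b \<Rightarrow> 'a) \<Rightarrow> 'b set \<Rightarrow> bool" where
  "totally_singular Q W \<longleftrightarrow> subspace W \<and> (\<forall>x\<in>W. Q x = 0)"

text \<open>For a quadratic form the maximum is taken over a finite set that contains 0, the
  dimension of the zero subspace.\<close>

definition witt_index :: "('b \<Rightarrow> 'a) \<Rightarrow> nat" where
  "witt_index Q = Max {dim W | W. totally_singular Q W}"

definition plus_type :: "('b \<Rightarrow> 'a) \<Rightarrow> bool" where
  "plus_type Q \<longleftrightarrow>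
     quadratic_form Q \<and> nondegenerate_form (polar_form Q) \<and> 2 * witt_index Q = dim UNIV"

definition symplectic_partial_spread :: "('b \<Rightarrow> 'b \<Rightarrow> 'a) \<Rightarrow> nat \<Rightarrow> 'b set set \<Rightarrow> bool" where
  "symplectic_partial_spread B n S \<longleftrightarrow>
     (\<forall>W\<in>S. totally_isotropic B W \<and> dim W = n) \<and>
     (\<forall>W\<in>S. \<forall>W'\<in>S. W \<noteq> W' \<longrightarrow> W \<inter> W' = {0})"

definition maximal_symplectic_partial_spread ::
    "('b \<Rightarrow> 'b \<Rightarrow> 'a) \<Rightarrow> nat \<Rightarrow> 'b set set \<Rightarrow> bool" where
  "maximal_symplectic_partial_spread B n S \<longleftrightarrow>
     symplectic_partial_spread B n S \<and>
     \<not> (\<exists>T. symplectic_partial_spread B n T \<and> S \<subset> T)"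

definition orthogonal_partial_spread :: "('b \<Rightarrow> 'a) \<Rightarrow> nat \<Rightarrow> 'b set set \<Rightarrow> bool" where
  "orthogonal_partial_spread Q n S \<longleftrightarrow>
     (\<forall>W\<in>S. totally_singular Q W \<and> dim W = n) \<and>
     (\<forall>W\<in>S. \<forall>W'\<in>S. W \<noteq> W' \<longrightarrow> W \<inter> W' = {0})"

definition maximal_orthogonal_partial_spread ::
    "('b \<Rightarrow> 'a) \<Rightarrow> nat \<Rightarrow> 'b set set \<Rightarrow> bool" where
  "maximal_orthogonal_partial_spread Q n S \<longleftrightarrow>
     orthogonal_partial_spread Q n S \<and>
     \<not> (\<exists>T. orthogonal_partial_spread Q n T \<and> S \<subset> T)"

end

text \<open>The Sp(2n,q)-spaces, where q is the cardinality of the scalar field.\<close>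

locale sp_space = fq_space scale
  for scale :: "'a::{field,finite} \<Rightarrow> 'b::ab_group_add \<Rightarrow> 'b" +
  fixes B :: "'b \<Rightarrow> 'b \<Rightarrow> 'a" and n :: nat
  assumes dim_space: "dim UNIV = 2 * n"
    and alternating: "alternating_form B"
    and nondegenerate: "nondegenerate_form B"

end

theory Submission
  imports Defs "HOL-Algebra.Algebraic_Closure_Type" "HOL-Library.Product_Plus"
begin

text \<open>Let \<open>K\<close> be the field with \<open>q ^ k\<close> elements and \<open>f : K \<rightarrow> F\<^sub>q\<close> a nonzero linear functional. Coordinates
  \<open>(u, w) \<in> K\<^sup>2 \<times> K\<^sup>2\<close> are chosen so that \<open>B\<close> is built from the pairing \<open>\<langle>u, w\<rangle> = f (u \<cdot> w)\<close>. The spreads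
  consist of \<open>0 \<times> K\<^sup>2\<close> and of the graphs of symmetric \<open>2 \<times> 2\<close> matrices over \<open>K\<close>, with rows
  \<open>(0, b), (b, 0)\<close> in part (i), where \<open>Q (u, w) = \<langle>u, w\<rangle>\<close>, and with rows
  \<open>(e, b), (b, b\<^sup>2 + e)\<close>, \<open>e \<in> {0, 1}\<close>, in part (ii).

  For maximality, a further member would be the graph of a self-adjoint additive map
  \<open>F = (F\<^sub>1, F\<^sub>2)\<close>. It meets one of the graphs as soon as the quadratic map
  \<open>g (x, y) = x F\<^sub>1 + y F\<^sub>2 + d F\<^sub>1\<^sup>2\<close> (\<open>d = 0\<close>, resp. \<open>d = 1\<close>) has a nonzero zero: take \<open>b = F\<^sub>1 / y\<close>
  if \<open>y \<noteq> 0\<close> (and \<open>e = 0\<close>), otherwise \<open>b = F\<^sub>2 / x\<close> and \<open>e = F\<^sub>1 / x \<in> {0, 1}\<close>. Because \<open>f \<circ> g\<close> is additive in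
  characteristic 2, over the field with 2 elements one coordinate of \<open>g\<close> becomes linear, and the
  remaining ones have too small a total degree not to have a common nonzero zero, by the
  Chevalley--Warning theorem; this instance is proved here with character sums.\<close>

subsection \<open>Zeros of quadratic maps in characteristic 2\<close>

lemma additive_image_eq:
  fixes H :: "'g::cancel_semigroup_add set"
  assumes "finite H" "\<And>x y. x \<in> H \<Longrightarrow> y \<in> H \<Longrightarrow> x + y \<in> H" "h \<in> H"
  shows "bij_betw (\<lambda>x. h + x) H H"
  using assms by (simp add: bij_betw_def endo_inj_surj image_subset_iff inj_on_def)

text \<open>The values are integers rather than scalars so that character sums can be tested for
  divisibility by powers of 2.\<close>

definition sign_character :: "'g::plus set \<Rightarrow> ('g \<Rightarrow> int) \<Rightarrow> bool" where
  "sign_character H \<psi> \<longleftrightarrow>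
     (\<forall>x\<in>H. \<psi> x = 1 \<or> \<psi> x = -1) \<and> (\<forall>x\<in>H. \<forall>y\<in>H. \<psi> (x + y) = \<psi> x * \<psi> y)"

text \<open>If \<open>\<psi> h = -1\<close>, translation by \<open>h\<close> permutes
  \<open>H\<close> and negates the sum, which therefore vanishes.\<close>

lemma sum_sign_character:
  fixes H :: "'g::cancel_semigroup_add set"
  assumes "finite H" "\<And>x y. x \<in> H \<Longrightarrow> y \<in> H \<Longrightarrow> x + y \<in> H" "sign_character H \<psi>"
  shows "sum \<psi> H = (if \<forall>x\<in>H. \<psi> x = 1 then int (card H) else 0)"
proof (cases "\<forall>x\<in>H. \<psi> x = 1")
  case False
  then obtain h where h: "h \<in> H" "\<psi> h = -1"
    using assms(3) by (auto simp: sign_character_def)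
  have "sum \<psi> H = (\<Sum>x\<in>H. \<psi> (h + x))"
    using sum.reindex_bij_betw[OF additive_image_eq[OF assms(1,2) h(1)], of \<psi>] by simp
  also have "\<dots> = (\<Sum>x\<in>H. - \<psi> x)"
    using assms(3) h by (intro sum.cong) (auto simp: sign_character_def)
  finally have "sum \<psi> H = 0"
    by (simp add: sum_negf)
  then show ?thesis
    using False by auto
qed simp

text \<open>For nonzero \<open>s\<close> the exponent of 2 in \<open>2 * s\<^sup>2\<close> is odd,
  so if it is at least \<open>2 * m\<close> it is at least \<open>2 * m + 1\<close>. Parity thus
  makes up for the factor 2 that is lost when a kernel has index 2.\<close>

lemma pow2_dvd_of_dvd_square:
  fixes s :: int
  assumes "(2::int) ^ (2 * m) dvd 2 * s\<^sup>2"
  shows "2 ^ m dvd s"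
proof (cases m)
  case (Suc l)
  have "2 * (2 ^ l)\<^sup>2 * 2 dvd 2 * s\<^sup>2"
    using assms by (simp add: Suc power_mult power2_eq_square algebra_simps)
  then have d: "(2 ^ l)\<^sup>2 * 2 dvd s\<^sup>2"
    by (simp only: mult.assoc dvd_mult_cancel_left) simp
  then have "(2 ^ l)\<^sup>2 dvd s\<^sup>2"
    by (rule dvd_mult_left)
  then have "2 ^ l dvd s"
    by simp
  then obtain t where t: "s = 2 ^ l * t" ..
  with d have "(2 ^ l)\<^sup>2 * 2 dvd (2 ^ l)\<^sup>2 * t\<^sup>2"
    by (simp add: power_mult_distrib)
  then have "even (t\<^sup>2)"
    by (simp only: dvd_mult_cancel_left) simp
  then have "even t"
    by simp
  with t show ?thesis
    by (auto simp: Suc)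
qed simp

text \<open>On the kernel \<open>V\<close> of \<open>\<chi> \<circ> g\<close>, each sum \<open>S c = (\<Sum>v\<in>V. \<chi> (c * g v))\<close> has its square divisible by
  \<open>card V\<close>, hence is divisible by \<open>card K\<close>, and \<open>S (c + 1) = S c\<close>. Therefore
  \<open>(\<Sum>c\<in>K. S c)\<close>, which is \<open>card K\<close> times the number of zeros, is divisible by \<open>2 * card K\<close>.\<close>

lemma quadratic_map_has_zero:
  fixes K :: "'l::field set" and G :: "'g::ab_group_add set" and g :: "'g \<Rightarrow> 'l"
    and \<chi> :: "'l \<Rightarrow> int"
  assumes K: "card K = 2 ^ m" "1 \<in> K" "\<And>x y. x \<in> K \<Longrightarrow> y \<in> K \<Longrightarrow> x + y \<in> K"
      "\<And>x y. x \<in> K \<Longrightarrow> y \<in> K \<Longrightarrow> x * y \<in> K" "\<And>x. x \<in> K \<Longrightarrow> inverse x \<in> K"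
    and char2: "(1::'l) + 1 = 0"
    and \<chi>: "sign_character K \<chi>" "a \<in> K" "\<chi> a = -1"
    and G: "card G = 2 ^ (2 * m)" "0 \<in> G" "\<And>x y. x \<in> G \<Longrightarrow> y \<in> G \<Longrightarrow> x + y \<in> G"
    and g: "\<And>x. x \<in> G \<Longrightarrow> g x \<in> K"
      "\<And>x y z. x \<in> G \<Longrightarrow> y \<in> G \<Longrightarrow> z \<in> G \<Longrightarrow>
        polar_form g (x + y) z = polar_form g x z + polar_form g y z"
    and \<chi>g: "\<And>x y. x \<in> G \<Longrightarrow> y \<in> G \<Longrightarrow> \<chi> (g (x + y)) = \<chi> (g x) * \<chi> (g y)"
  shows "\<exists>x\<in>G. x \<noteq> 0 \<and> g x = 0"
proof -
  have finK: "finite K" and finG: "finite G"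
    using K(1) G(1) by (auto intro: card_ge_0_finite)
  have dbl: "x + x = 0" for x :: 'l
    using char2 by (metis distrib_left mult_zero_right mult_1_right)
  have sub: "x - y = x + y" for x y :: 'l
    using dbl[of y] by (simp add: diff_eq_eq add.assoc)
  define V where "V = {v\<in>G. \<chi> (g v) = 1}"
  have finV: "finite V" and VG: "V \<subseteq> G"
    using finG by (auto simp: V_def)
  have V_add: "x + y \<in> V" if "x \<in> V" "y \<in> V" for x y
    using that G(3) \<chi>g by (auto simp: V_def)
  have zero: "0 \<in> V" "g 0 = 0"
  proof -
    have "polar_form g 0 0 = polar_form g 0 0 + polar_form g 0 0"
      using g(2)[of 0 0 0] G(2) by simp
    then have "polar_form g 0 0 = 0"
      by (metis add_cancel_left_right)
    then show "g 0 = 0"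
      by (simp add: polar_form_def)
    have "\<chi> (g 0) = \<chi> (g 0) * \<chi> (g 0)"
      using \<chi>g[of 0 0] G(2) by simp
    then show "0 \<in> V"
      using \<chi>(1) g(1)[of 0] G(2) by (auto simp: V_def sign_character_def)
  qed
  have char_g: "sign_character G (\<lambda>v. \<chi> (g v))"
    using \<chi>(1) g(1) \<chi>g by (auto simp: sign_character_def)
  \<comment> \<open>\<open>V\<close> has index at most 2 in \<open>G\<close>: summing
    \<open>\<chi> (g v) + 1\<close> counts each element of \<open>V\<close> twice, and the character
    sum over \<open>G\<close> is 0 or \<open>card G\<close>.\<close>
  have cardV: "int (card G) dvd 2 * int (card V)"
  proof -
    have "(\<Sum>v\<in>G. \<chi> (g v)) + int (card G) = (\<Sum>v\<in>G. \<chi> (g v) + 1)"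
      by (simp add: sum.distrib)
    also have "\<dots> = (\<Sum>v\<in>V. \<chi> (g v) + 1)"
      using finG char_g by (intro sum.mono_neutral_right) (auto simp: V_def sign_character_def)
    also have "\<dots> = (\<Sum>v\<in>V. 2)"
      by (intro sum.cong) (auto simp: V_def)
    finally have "(\<Sum>v\<in>G. \<chi> (g v)) + int (card G) = 2 * int (card V)"
      by simp
    moreover have "int (card G) dvd (\<Sum>v\<in>G. \<chi> (g v))"
      using sum_sign_character[OF finG G(3) char_g] by simp
    ultimately show ?thesis
      by (metis dvd_add dvd_refl)
  qed
  define S where "S c = (\<Sum>v\<in>V. \<chi> (c * g v))" for c
  have S_dvd: "2 ^ m dvd S c" if c: "c \<in> K" for c
  proof -
    have cg: "c * g v \<in> K" if "v \<in> G" for v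
      using that c g(1) K(4) by blast
    have cK: "c * polar_form g v z \<in> K" if "v \<in> G" "z \<in> G" for v z
      using that c g(1) K(3,4) G(3) by (simp add: polar_form_def sub)
    have inner: "(\<Sum>v\<in>V. \<chi> (c * g v) * \<chi> (c * g (z + v)))
        = \<chi> (c * g z) * (\<Sum>v\<in>V. \<chi> (c * polar_form g v z))" if z: "z \<in> V" for z
      unfolding sum_distrib_left
    proof (intro sum.cong refl)
      fix v assume v: "v \<in> V"
      have "c * g (z + v) = c * g v + (c * g z + c * polar_form g v z)"
        by (simp add: polar_form_def algebra_simps)
      then have "\<chi> (c * g (z + v)) = \<chi> (c * g v) * (\<chi> (c * g z) * \<chi> (c * polar_form g v z))"
        using \<chi>(1) z v VG cg cK K(3) by (simp add: sign_character_def subset_iff)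
      moreover have "\<chi> (c * g v) * \<chi> (c * g v) = 1"
        using \<chi>(1) v VG cg by (fastforce simp add: sign_character_def)
      ultimately show "\<chi> (c * g v) * \<chi> (c * g (z + v)) = \<chi> (c * g z) * \<chi> (c * polar_form g v z)"
        by (metis mult.assoc mult_1)
    qed
    \<comment> \<open>The substitution \<open>w = v + z\<close> in the double sum cancels the terms
      quadratic in \<open>v\<close>. For fixed \<open>z\<close> there remains, up to a sign, the sum
      over \<open>v\<close> of a character of \<open>V\<close>, which is 0 or
      \<open>card V\<close>.\<close>
    have "(S c)\<^sup>2 = (\<Sum>v\<in>V. \<chi> (c * g v) * (\<Sum>w\<in>V. \<chi> (c * g w)))"
      by (simp add: S_def power2_eq_square sum_distrib_right)
    also have "\<dots> = (\<Sum>v\<in>V. \<chi> (c * g v) * (\<Sum>z\<in>V. \<chi> (c * g (v + z))))"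
    proof (intro sum.cong refl)
      fix v assume "v \<in> V"
      then show "\<chi> (c * g v) * (\<Sum>w\<in>V. \<chi> (c * g w)) = \<chi> (c * g v) * (\<Sum>z\<in>V. \<chi> (c * g (v + z)))"
        using sum.reindex_bij_betw[OF additive_image_eq[OF finV V_add, of v], of "\<lambda>w. \<chi> (c * g w)"]
        by simp
    qed
    also have "\<dots> = (\<Sum>z\<in>V. \<Sum>v\<in>V. \<chi> (c * g v) * \<chi> (c * g (z + v)))"
      unfolding sum_distrib_left by (subst sum.swap) (simp only: add.commute)
    also have "\<dots> = (\<Sum>z\<in>V. \<chi> (c * g z) * (\<Sum>v\<in>V. \<chi> (c * polar_form g v z)))"
      by (intro sum.cong refl inner)
    also have "int (card V) dvd \<dots>"
    proof (rule dvd_sum[OF dvd_mult])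
      fix z assume z: "z \<in> V"
      have "sign_character V (\<lambda>v. \<chi> (c * polar_form g v z))"
        unfolding sign_character_def
      proof (intro conjI ballI)
        fix v assume v: "v \<in> V"
        show "\<chi> (c * polar_form g v z) = 1 \<or> \<chi> (c * polar_form g v z) = - 1"
          using \<chi>(1) cK[of v z] v z VG by (auto simp: sign_character_def)
        fix w assume w: "w \<in> V"
        have "c * polar_form g (v + w) z = c * polar_form g v z + c * polar_form g w z"
          using g(2)[of v w z] v w z VG by (simp add: subset_iff distrib_left)
        then show "\<chi> (c * polar_form g (v + w) z)
            = \<chi> (c * polar_form g v z) * \<chi> (c * polar_form g w z)"
          using \<chi>(1) cK[of v z] cK[of w z] v w z VG by (auto simp: sign_character_def)
      qed
      from sum_sign_character[OF finV V_add this]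
      show "int (card V) dvd (\<Sum>v\<in>V. \<chi> (c * polar_form g v z))"
        by (metis dvd_0_right dvd_refl)
    qed
    finally have "2 * int (card V) dvd 2 * (S c)\<^sup>2"
      by simp
    with cardV have "int (card G) dvd 2 * (S c)\<^sup>2"
      by (rule dvd_trans)
    then show ?thesis
      by (intro pow2_dvd_of_dvd_square[of m "S c"]) (simp add: G(1))
  qed
  have S_shift: "S (c + 1) = S c" if "c \<in> K" for c
    unfolding S_def
  proof (intro sum.cong refl)
    fix v assume v: "v \<in> V"
    then have "\<chi> (c * g v + g v) = \<chi> (c * g v) * \<chi> (g v)"
      using that \<chi>(1) g(1) K(4) VG by (auto simp: sign_character_def)
    then show "\<chi> ((c + 1) * g v) = \<chi> (c * g v)"
      using v by (simp add: V_def algebra_simps)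
  qed
  \<comment> \<open>As \<open>\<chi> a = -1\<close>, adding 1 to \<open>c\<close> flips the sign of
    \<open>\<chi> (c * a)\<close>. So \<open>P\<close> contains exactly one element of each pair
    \<open>c\<close>, \<open>1 + c\<close> in \<open>K\<close>, and \<open>S\<close> agrees on the
    pair.\<close>
  define P where "P = {c\<in>K. \<chi> (c * a) = 1}"
  have shift_a: "\<chi> ((1 + c) * a) = - \<chi> (c * a)" if "c \<in> K" for c
    using that \<chi> K(4) by (simp add: sign_character_def algebra_simps)
  have "(\<Sum>c\<in>K. S c) = (\<Sum>c\<in>P. S c) + (\<Sum>c\<in>K-P. S c)"
    using finK by (metis (no_types, lifting) P_def add.commute mem_Collect_eq subsetI sum.subset_diff)
  also have "(\<Sum>c\<in>K-P. S c) = (\<Sum>c\<in>P. S c)"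
  proof (rule sum.reindex_bij_witness[of _ "\<lambda>c. 1 + c" "\<lambda>c. 1 + c"])
    fix c assume c: "c \<in> K - P"
    then have "\<chi> (c * a) = -1"
      using \<chi>(1,2) K(4) by (auto simp: P_def sign_character_def)
    then show "1 + c \<in> P"
      using c shift_a K(2,3) by (simp add: P_def)
    show "S (1 + c) = S c"
      using c S_shift[of c] by (simp add: add.commute)
  next
    fix c assume c: "c \<in> P"
    then show "1 + c \<in> K - P"
      using shift_a[of c] K(2,3) by (simp add: P_def)
  qed (use char2 in \<open>simp_all add: add.assoc[symmetric]\<close>)
  finally have "(\<Sum>c\<in>K. S c) = 2 * (\<Sum>c\<in>P. S c)"
    by simp
  moreover have "2 ^ m dvd (\<Sum>c\<in>P. S c)"
    by (intro dvd_sum S_dvd) (simp add: P_def)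
  ultimately have dvd: "2 * 2 ^ m dvd (\<Sum>c\<in>K. S c)"
    by simp
  define Z where "Z = {v\<in>V. g v = 0}"
  have "(\<Sum>c\<in>K. S c) = (\<Sum>v\<in>V. \<Sum>c\<in>K. \<chi> (c * g v))"
    unfolding S_def by (rule sum.swap)
  also have "\<dots> = (\<Sum>v\<in>V. if g v = 0 then 2 ^ m else 0)"
  proof (intro sum.cong refl)
    fix v assume "v \<in> V"
    then have gv: "g v \<in> K"
      using g(1) VG by auto
    have "sign_character K (\<lambda>c. \<chi> (c * g v))"
      using \<chi>(1) K(4) gv by (simp add: sign_character_def distrib_right)
    note * = sum_sign_character[OF finK K(3) this]
    show "(\<Sum>c\<in>K. \<chi> (c * g v)) = (if g v = 0 then 2 ^ m else 0)"
    proof (cases "g v = 0")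
      case True
      have "0 \<in> K"
        using K(2) K(3)[of 1 1] char2 by simp
      then have "\<chi> 0 = \<chi> 0 * \<chi> 0" "\<chi> 0 = 1 \<or> \<chi> 0 = -1"
        using \<chi>(1) by (metis add_0 sign_character_def)+
      then show ?thesis
        using True K(1) by auto
    next
      case False
      \<comment> \<open>The multiplier \<open>a / g v\<close> carries \<open>g v\<close> to
        \<open>a\<close>, so the character is nontrivial and its sum vanishes.\<close>
      have "a * inverse (g v) \<in> K" "\<chi> (a * inverse (g v) * g v) \<noteq> 1"
        using False gv \<chi> K(4,5) by (auto simp: mult.assoc)
      then show ?thesis
        using * False by meson
    qed
  qed
  also have "\<dots> = (\<Sum>v\<in>Z. 2 ^ m)"
    unfolding Z_def by (rule sum.inter_filter[symmetric, OF finV])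
  also have "\<dots> = int (card Z) * 2 ^ m"
    by simp
  \<comment> \<open>Cancelling \<open>2 ^ m\<close> leaves an even number of zeros in
    \<open>V\<close>; as 0 is one of them, there is another.\<close>
  finally have "even (card Z)"
    using dvd by simp
  then have "Z \<noteq> {0}"
    by auto
  moreover have "0 \<in> Z"
    using zero by (simp add: Z_def)
  ultimately obtain v where "v \<in> Z" "v \<noteq> 0"
    by auto
  then show ?thesis
    using VG by (auto simp: Z_def)
qed

subsection \<open>Finite vector spaces and field extensions\<close>

locale finite_field_space = vector_space scale
  for scale :: "'a::{field,finite} \<Rightarrow> 'b::ab_group_add \<Rightarrow> 'b"
begin

text \<open>Describing the span by pairs of a coefficient and a vector of \<open>span S\<close> lets
  finiteness and cardinality be proved by induction on the generators.\<close>

lemma span_insert_eq_image: "span (insert a S) = (\<lambda>(c, y). scale c a + y) ` (UNIV \<times> span S)"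
proof (intro subset_antisym subsetI)
  fix x assume "x \<in> span (insert a S)"
  then obtain c where "x - scale c a \<in> span S"
    by (auto simp: span_breakdown_eq)
  then show "x \<in> (\<lambda>(c, y). scale c a + y) ` (UNIV \<times> span S)"
    by (intro image_eqI[of _ _ "(c, x - scale c a)"]) auto
next
  fix x assume "x \<in> (\<lambda>(c, y). scale c a + y) ` (UNIV \<times> span S)"
  then obtain c y where "y \<in> span S" "x = scale c a + y"
    by auto
  then have "x - scale c a \<in> span S"
    by simp
  then show "x \<in> span (insert a S)"
    unfolding span_breakdown_eq ..
qed

lemma finite_span_of_finite: "finite S \<Longrightarrow> finite (span S)"
  by (induction S rule: finite_induct) (auto simp: span_insert_eq_image)

lemma card_span_independent:
  assumes "finite S" "independent S"
  shows "card (span S) = CARD('a) ^ card S"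
  using assms
proof (induction S rule: finite_induct)
  case (insert a S)
  then have a: "a \<notin> span S" and "independent S"
    by (auto simp: independent_insert)
  have "inj_on (\<lambda>(c, y). scale c a + y) (UNIV \<times> span S)"
  proof (clarsimp simp: inj_on_def)
    fix c d y z
    assume yz: "y \<in> span S" "z \<in> span S" and eq: "scale c a + y = scale d a + z"
    have "scale (c - d) a = z - y"
      using eq by (simp add: scale_left_diff_distrib algebra_simps)
    then have "scale (c - d) a \<in> span S"
      using yz by (simp add: span_diff)
    then have "c - d = 0"
      using a span_scale[of "scale (c - d) a" S "inverse (c - d)"]
      by (cases "c - d = 0") (simp_all del: right_minus_eq)
    then show "c = d \<and> y = z"
      using eq by simp
  qed
  then show ?case
    using insert \<open>independent S\<close>
    by (simp add: span_insert_eq_image card_image card_cartesian_product)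
qed simp

lemma card_subspace:
  assumes "subspace S" "finite S"
  shows "card S = CARD('a) ^ dim S"
proof -
  obtain C where C: "C \<subseteq> S" "independent C" "S \<subseteq> span C" "card C = dim S"
    by (rule basis_exists)
  then have "span C = S"
    using assms by (intro span_subspace)
  moreover have "finite C"
    using C(1) assms(2) by (rule finite_subset)
  ultimately show ?thesis
    using card_span_independent[of C] C by simp
qed

text \<open>The field has at least two elements, so a power of its order determines the exponent.
  This lets dimensions be found by counting.\<close>

lemma dim_subspace_eq:
  assumes "subspace S" "finite S" "card S = CARD('a) ^ d"
  shows "dim S = d"
proof -
  have "card {0, 1 :: 'a} \<le> CARD('a)"
    by (intro card_mono) auto
  then show ?thesis
    using card_subspace[OF assms(1,2)] assms(3) by simp
qed

end

section \<open>Finite fields of characteristic 2 and their sign characters\<close>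

text \<open>If \<open>1 + 1\<close> were nonzero, negation would split the nonzero elements into
  pairs and make the order of the field odd.\<close>

lemma char_2_if_even_card:
  assumes "even CARD('a::{field,finite})"
  shows "(1::'a) + 1 = 0"
proof (rule ccontr)
  assume n: "(1::'a) + 1 \<noteq> 0"
  have neg: "x \<noteq> - x" if "x \<noteq> 0" for x :: 'a
  proof
    assume "x = - x"
    then have "x + x = 0"
      by (metis add.right_inverse)
    then have "x * (1 + 1) = 0"
      by (simp only: distrib_left mult_1_right)
    then show False
      using that n by (simp only: mult_eq_0_iff) simp
  qed
  have two: "card {x, - x} = 2" if "x \<noteq> 0" for x :: 'a
    using neg[OF that] by (metis card_2_iff)
  define C where "C = (\<lambda>x. {x, - x}) ` (UNIV - {0 :: 'a})"
  have "2 * card C = card (\<Union>C)"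
    by (rule card_partition) (auto simp: C_def intro!: two)
  moreover have "\<Union>C = UNIV - {0}"
    by (auto simp: C_def)
  ultimately have "2 * card C = CARD('a) - 1"
    by (simp add: card_Diff_singleton)
  moreover have "CARD('a) > 0"
    by simp
  ultimately have "CARD('a) = Suc (2 * card C)"
    by linarith
  then show False
    using assms by simp
qed

lemma gf2_cases: "(c::gf2) = 0 \<or> c = 1"
  by transfer auto

lemma gf2_add_self [simp]: "(c::gf2) + c = 0"
  by transfer auto

lemma card_gf2: "CARD(gf2) = 2"
proof -
  have "UNIV = {0, 1 :: gf2}"
    using gf2_cases by auto
  then show ?thesis
    by (metis card_2_iff zero_neq_one)
qed

text \<open>The field is a vector space over \<open>gf2\<close>, so its order is a power of 2. A
  linear functional to \<open>gf2\<close> with value 1 at 1, turned into a sign, is the required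
  character.\<close>

lemma char_2_sign_character:
  assumes char2: "(1::'a::{field,finite}) + 1 = 0"
  shows "\<exists>e. CARD('a) = 2 ^ e" "\<exists>\<mu>::'a \<Rightarrow> int. sign_character UNIV \<mu> \<and> \<mu> 1 = -1"
proof -
  define s where "s c x = (if c = 0 then 0 else x)" for c :: gf2 and x :: 'a
  have dbl: "x + x = 0" for x :: 'a
    using char2 by (metis distrib_left mult_zero_right mult_1_right)
  have s: "s 0 x = 0" "s 1 x = x" for x
    by (simp_all add: s_def)
  interpret finite_field_space s
  proof
    fix a b :: gf2 and x y :: 'a
    show "s (a + b) x = s a x + s b x"
      using gf2_cases[of a] gf2_cases[of b] dbl by (auto simp: s)
  qed (auto simp: s_def)
  show "\<exists>e. CARD('a) = 2 ^ e"
    using card_subspace[OF subspace_UNIV] by (auto simp: card_gf2)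
  interpret pair: vector_space_pair s "(*) :: gf2 \<Rightarrow> gf2 \<Rightarrow> gf2"
    by unfold_locales (auto simp: algebra_simps)
  have "independent {1}"
    by simp
  from pair.linear_independent_extend[OF this, of "\<lambda>_. 1"]
  obtain f where f: "Vector_Spaces.linear s (*) f" "f 1 = 1"
    by auto
  interpret f: Vector_Spaces.linear s "(*)" f
    by (rule f(1))
  have "sign_character UNIV (\<lambda>x. if f x = 0 then 1 else -1 :: int)"
    unfolding sign_character_def
  proof (intro conjI ballI)
    fix x y
    show "(if f (x + y) = 0 then 1 else - 1 :: int)
        = (if f x = 0 then 1 else - 1) * (if f y = 0 then 1 else - 1)"
      using gf2_cases[of "f x"] gf2_cases[of "f y"] by (auto simp: f.add)
  qed auto
  then show "\<exists>\<mu>::'a \<Rightarrow> int. sign_character UNIV \<mu> \<and> \<mu> 1 = -1"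
    using f(2) by (intro exI[of _ "\<lambda>x. if f x = 0 then 1 else -1"]) simp
qed

section \<open>The extension field of degree \<open>k\<close> inside the algebraic closure\<close>

text \<open>The fixed points of the \<open>k\<close>-th power of the Frobenius map. The field is a
  subset of one fixed type because its degree \<open>k\<close> is a variable.\<close>

definition ext_field :: "nat \<Rightarrow> 'a::{field,finite} alg_closure set" where
  "ext_field k = {x. x ^ (CARD('a) ^ k) = x}"

text \<open>Multiplication by a nonzero \<open>x\<close> permutes the nonzero elements; comparing
  their products gives \<open>x ^ (q - 1) = 1\<close>, where \<open>q\<close> is the order of the
  field.\<close>

lemma finite_field_power_card:
  fixes x :: "'a::{field,finite}"
  shows "x ^ CARD('a) = x"
proof (cases "x = 0")
  case False
  have "bij_betw ((*) x) (UNIV - {0}) (UNIV - {0})"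
    using False by (intro bij_betw_byWitness[where f' = "\<lambda>y. y / x"]) auto
  then have "(\<Prod>y\<in>UNIV - {0}. y) = (\<Prod>y\<in>UNIV - {0}. x * y)"
    by (rule prod.reindex_bij_betw[symmetric])
  also have "\<dots> = x ^ (CARD('a) - 1) * (\<Prod>y\<in>UNIV - {0}. y)"
    by (simp add: prod.distrib card_Diff_singleton)
  finally have "x ^ (CARD('a) - 1) = 1"
    by simp
  then show ?thesis
    by (metis finite_UNIV_card_ge_0 finite_class.finite_UNIV mult.right_neutral power_minus_mult mult_1)
qed (simp add: zero_power)

lemma power_card_power:
  fixes x :: "'a::{field,finite}"
  shows "x ^ (CARD('a) ^ k) = x"
  by (induction k) (simp_all add: power_mult finite_field_power_card)

lemma ext_field_basic:
  shows "1 \<in> ext_field k" "0 \<in> ext_field k"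
    "x \<in> ext_field k \<Longrightarrow> y \<in> ext_field k \<Longrightarrow> x * y \<in> ext_field k"
    "x \<in> ext_field k \<Longrightarrow> inverse x \<in> ext_field k"
    "x \<in> ext_field k \<Longrightarrow> y \<in> ext_field k \<Longrightarrow> x / y \<in> ext_field k"
    "to_ac c \<in> ext_field k"
  by (auto simp: ext_field_def power_mult_distrib power_inverse power_divide zero_power
      power_card_power simp flip: to_ac_power)

text \<open>The exponent \<open>CARD('a) ^ k\<close> is a power of the characteristic 2, so raising
  to it is additive.\<close>

lemma ext_field_add:
  assumes "(1::'a::{field,finite}) + 1 = 0"
    and "x \<in> ext_field k" "y \<in> ext_field k"
  shows "x + y \<in> (ext_field k :: 'a alg_closure set)"
proof -
  obtain e where e: "CARD('a) = 2 ^ e"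
    using char_2_sign_character(1)[OF assms(1)] by blast
  have "of_nat 2 = (0::'a)"
    using assms(1) by simp
  then have "CHAR('a) dvd 2"
    by (simp only: of_nat_eq_0_iff_char_dvd)
  then have "CHAR('a) = 2"
    by (metis CHAR_not_1' One_nat_def prime_nat_iff two_is_prime_nat)
  then have "prime CHAR('a alg_closure)" "CARD('a) ^ k = CHAR('a alg_closure) ^ (e * k)"
    by (simp_all add: e power_mult)
  from freshmans_dream'[OF this] show ?thesis
    using assms(2,3) by (simp add: ext_field_def)
qed

text \<open>The set consists of the roots of \<open>X ^ N - X\<close>. Over an algebraically closed
  field this polynomial has \<open>N\<close> roots with multiplicity, and they are simple because
  its derivative is -1.\<close>

lemma card_ext_field:
  assumes "(1::'a::{field,finite}) + 1 = 0" "k \<ge> 1"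
  shows "card (ext_field k :: 'a alg_closure set) = CARD('a) ^ k"
proof -
  define N where "N = CARD('a) ^ k"
  obtain e where e: "CARD('a) = 2 ^ e"
    using char_2_sign_character(1)[OF assms(1)] by blast
  have "card {0, 1 :: 'a} \<le> CARD('a)"
    by (intro card_mono) auto
  then have "e \<noteq> 0"
    using e by (intro notI) simp
  then have "even N"
    using e assms(2) by (simp add: N_def)
  have "(2::'a alg_closure) = to_ac (1 + 1)"
    by (simp only: to_ac_add to_ac_1 one_add_one[symmetric])
  then have two: "(2::'a alg_closure) = 0"
    by (simp only: assms(1) to_ac_0)
  have N0: "of_nat N = (0::'a alg_closure)"
    using \<open>even N\<close> two by (auto elim!: evenE)
  have "N > 0"
    by (simp add: N_def)
  with \<open>even N\<close> have "N > 1"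
    by presburger
  define p :: "'a alg_closure poly" where "p = monom 1 N - monom 1 1"
  have "coeff p N = 1"
    using \<open>N > 1\<close> by (simp add: p_def)
  then have "p \<noteq> 0"
    by auto
  have "degree p = N"
    unfolding p_def diff_conv_add_uminus using \<open>N > 1\<close>
    by (subst degree_add_eq_left) (auto simp: degree_monom_eq)
  have dp: "pderiv p = - 1"
    using N0 by (simp add: p_def pderiv_diff pderiv_monom monom_0 one_pCons)
  obtain A where A: "size A = degree p" "p = smult (lead_coeff p) (\<Prod>x\<in>#A. [:-x, 1:])"
    using alg_closed_imp_factorization[OF \<open>p \<noteq> 0\<close>] by blast
  \<comment> \<open>A repeated linear factor of \<open>p\<close> would divide the derivative, which
    is the nonzero constant -1.\<close>
  have "count A a = 1" if "a \<in># A" for a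
  proof (rule ccontr)
    assume "count A a \<noteq> 1"
    then have "count A a - 1 > 0"
      using that by (simp add: count_greater_zero_iff[symmetric] del: count_greater_zero_iff)
    then have "a \<in># A - {#a#}"
      by (simp add: count_greater_zero_iff[symmetric] del: count_greater_zero_iff)
    then obtain A' where "A - {#a#} = add_mset a A'"
      by (rule mset_add)
    then have A': "A = add_mset a (add_mset a A')"
      using that by (metis insert_DiffM)
    then have "p = [:-a, 1:] * ([:-a, 1:] * smult (lead_coeff p) (\<Prod>x\<in>#A'. [:-x, 1:]))"
      by (subst A(2)) (simp only: A' image_mset_add_mset prod_mset.add_mset mult_smult_right)
    then obtain r where "p = [:-a, 1:] * ([:-a, 1:] * r)"
      by blast
    then have "poly (pderiv p) a = 0"
      by (simp only: pderiv_mult poly_add poly_mult) simp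
    then show False
      by (simp add: dp)
  qed
  then have "card (set_mset A) = size A"
    by (simp add: size_multiset_overloaded_eq)
  moreover have "set_mset A = {x. poly p x = 0}"
  proof -
    have "poly p x = lead_coeff p * (\<Prod>y\<in>#A. x - y)" for x
      by (subst A(2)) (simp add: poly_prod_mset image_mset.compositionality o_def)
    moreover have "lead_coeff p \<noteq> 0"
      using \<open>p \<noteq> 0\<close> by simp
    ultimately show ?thesis
      by auto
  qed
  moreover have "{x. poly p x = 0} = ext_field k"
    by (simp add: p_def ext_field_def poly_monom N_def)
  ultimately show ?thesis
    using A(1) \<open>degree p = N\<close> by (simp add: N_def)
qed

text \<open>A linear extension of the value 1 at the independent vector 1. It serves to bring forms
  over the extension field down to \<open>'a\<close>, and the value at 1 keeps them
  nondegenerate.\<close>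

lemma exists_ac_functional:
  "\<exists>f::'a::{field,finite} alg_closure \<Rightarrow> 'a.
     (\<forall>x y. f (x + y) = f x + f y) \<and> (\<forall>c x. f (to_ac c * x) = c * f x) \<and> f 1 = 1"
proof -
  interpret pair: vector_space_pair "\<lambda>c (x::'a alg_closure). to_ac c * x" "(*) :: 'a \<Rightarrow> 'a \<Rightarrow> 'a"
    by unfold_locales (auto simp: algebra_simps)
  have "pair.vs1.independent {1 :: 'a alg_closure}"
    by simp
  from pair.linear_independent_extend[OF this, of "\<lambda>_. 1"] show ?thesis
    by (auto simp: Vector_Spaces.linear_iff)
qed

subsection \<open>Hyperbolic coordinates\<close>

sublocale fq_space \<subseteq> finite_field_space scale ..

context fq_space
begin

lemma finite_space: "finite (A :: 'b set)"
  using finite_span finite_span_of_finite by (metis finite_subset subset_UNIV)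

lemma dim_eq_if_card: "subspace S \<Longrightarrow> card S = CARD('a) ^ d \<Longrightarrow> dim S = d"
  by (rule dim_subspace_eq) (auto intro: finite_space)

end

locale char_2_sp_space = sp_space scale B n
  for scale :: "'a::{field,finite} \<Rightarrow> 'b::ab_group_add \<Rightarrow> 'b" and B n +
  assumes one_add_one_eq_0: "(1::'a) + 1 = 0"
begin

section \<open>Symplectic forms in characteristic 2 and perpendicular spaces\<close>

lemma form_simps:
  "B (x + y) z = B x z + B y z" "B z (x + y) = B z x + B z y"
  "B (scale c x) z = c * B x z" "B z (scale c x) = c * B z x"
  "B (x - y) z = B x z - B y z" "B z (x - y) = B z x - B z y"
  "B 0 z = 0" "B z 0 = 0" "B x x = 0"
proof -
  have *: "Vector_Spaces.linear scale (*) (B w)" "Vector_Spaces.linear scale (*) (\<lambda>v. B v w)" for w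
    using alternating by (auto simp: alternating_form_def bilinear_form_def)
  interpret l: Vector_Spaces.linear scale "(*)" "B z" by (rule *)
  interpret r: Vector_Spaces.linear scale "(*)" "\<lambda>v. B v z" by (rule *)
  show "B (x + y) z = B x z + B y z" "B z (x + y) = B z x + B z y"
    "B (scale c x) z = c * B x z" "B z (scale c x) = c * B z x"
    "B (x - y) z = B x z - B y z" "B z (x - y) = B z x - B z y"
    "B 0 z = 0" "B z 0 = 0"
    by (simp_all add: l.add r.add l.scale r.scale l.diff r.diff l.zero r.zero)
  show "B x x = 0"
    using alternating by (simp add: alternating_form_def)
qed

lemma add_self: "c + c = (0::'a)"
  using one_add_one_eq_0 by (metis distrib_left mult_zero_right mult_1_right)

text \<open>Expanding \<open>B (x + y) (x + y) = 0\<close> gives skew symmetry, which is symmetry in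
  characteristic 2.\<close>

lemma form_sym: "B x y = B y x"
proof -
  have "B (x + y) (x + y) = 0"
    by (rule form_simps)
  then have "B x y + B y x = 0"
    unfolding form_simps(1,2) by (simp add: form_simps(9) add.commute)
  then have "B x y + B y x = B y x + B y x"
    by (simp only: add_self)
  then show ?thesis
    by simp
qed

definition perp :: "'b set \<Rightarrow> 'b set" where
  "perp U = {v. \<forall>u\<in>U. B u v = 0}"

lemma subspace_perp: "subspace (perp U)"
  by (auto simp: perp_def form_simps intro: subspaceI)

lemma perp_mono: "U \<subseteq> W \<Longrightarrow> perp W \<subseteq> perp U"
  by (auto simp: perp_def)

lemma totally_isotropic_iff: "totally_isotropic B W \<longleftrightarrow> subspace W \<and> W \<subseteq> perp W"
  by (auto simp: totally_isotropic_def perp_def)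

lemma card_UNIV_space: "card (UNIV :: 'b set) = CARD('a) ^ (2 * n)"
  using card_subspace[OF subspace_UNIV finite_space] by (simp add: dim_space)

text \<open>Both orders of summation of \<open>\<mu> (B u v)\<close> over \<open>U \<times> V\<close> evaluate by character orthogonality.\<close>

lemma card_perp:
  assumes "subspace U"
  shows "card U * card (perp U) = CARD('a) ^ (2 * n)"
proof -
  obtain \<mu> :: "'a \<Rightarrow> int" where \<mu>: "sign_character UNIV \<mu>" "\<mu> 1 = -1"
    using char_2_sign_character(2)[OF one_add_one_eq_0] by blast
  have char_left: "sign_character W (\<lambda>u. \<mu> (B u v))" and char_right: "sign_character W (\<lambda>u. \<mu> (B v u))"
    for v W using \<mu>(1) by (auto simp: sign_character_def form_simps)
  have "\<mu> 0 = 1"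
    using \<mu>(1) by (metis UNIV_I add_0 mult_cancel_right1 sign_character_def one_neq_zero zero_neq_neg_one)
  have *: "(\<Sum>u\<in>U. \<mu> (B u v)) = (if v \<in> perp U then int (card U) else 0)" for v
  proof -
    have "(\<forall>u\<in>U. \<mu> (B u v) = 1) \<longleftrightarrow> v \<in> perp U"
    proof
      assume 1: "\<forall>u\<in>U. \<mu> (B u v) = 1"
      show "v \<in> perp U"
      proof (rule ccontr)
        assume "v \<notin> perp U"
        then obtain u where u: "u \<in> U" "B u v \<noteq> 0"
          by (auto simp: perp_def)
        \<comment> \<open>Rescaling turns a nonzero value of the form into 1, where
          \<open>\<mu>\<close> is -1.\<close>
        then have "\<mu> (B (scale (inverse (B u v)) u) v) = -1"
          using \<mu>(2) by (simp add: form_simps)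
        then show False
          using 1 u assms by (simp add: subspace_scale)
      qed
    qed (simp add: perp_def \<open>\<mu> 0 = 1\<close>)
    then show ?thesis
      using sum_sign_character[OF finite_space subspace_add[OF assms] char_left[of U v]] by simp
  qed
  have **: "(\<Sum>v\<in>UNIV. \<mu> (B u v)) = (if u = 0 then int (card (UNIV :: 'b set)) else 0)" for u
  proof -
    have "(\<forall>v\<in>UNIV. \<mu> (B u v) = 1) \<longleftrightarrow> u = 0"
    proof
      assume 1: "\<forall>v\<in>UNIV. \<mu> (B u v) = 1"
      show "u = 0"
      proof (rule ccontr)
        assume "u \<noteq> 0"
        then obtain v where v: "B u v \<noteq> 0"
          using nondegenerate by (auto simp: nondegenerate_form_def)
        then have "\<mu> (B u (scale (inverse (B u v)) v)) = -1"
          using \<mu>(2) by (simp add: form_simps)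
        then show False
          using 1 by simp
      qed
    qed (simp add: form_simps \<open>\<mu> 0 = 1\<close>)
    then show ?thesis
      using sum_sign_character[OF finite_space UNIV_I char_right[of UNIV u]] by simp
  qed
  have "(\<Sum>v\<in>UNIV. \<Sum>u\<in>U. \<mu> (B u v)) = int (card (perp U)) * int (card U)"
    unfolding * using finite_space by (simp add: sum.If_cases)
  moreover have "(\<Sum>u\<in>U. \<Sum>v\<in>UNIV. \<mu> (B u v)) = int (card (UNIV :: 'b set))"
    unfolding ** using finite_space[of U] subspace_0[OF assms] by simp
  moreover have "(\<Sum>v\<in>UNIV. \<Sum>u\<in>U. \<mu> (B u v)) = (\<Sum>u\<in>U. \<Sum>v\<in>UNIV. \<mu> (B u v))"
    by (rule sum.swap)
  ultimately have "int (card U * card (perp U)) = int (CARD('a) ^ (2 * n))"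
    by (simp add: card_UNIV_space mult.commute)
  then show ?thesis
    by (simp only: of_nat_eq_iff)
qed

lemma subspace_nonempty_card: "subspace U \<Longrightarrow> card U > 0"
  using subspace_0 finite_space card_gt_0_iff by blast

text \<open>One inclusion is the symmetry of \<open>B\<close>; the cardinalities agree by applying
  \<open>card_perp\<close> to \<open>U\<close> and to \<open>perp U\<close>.\<close>

lemma perp_perp:
  assumes "subspace U"
  shows "perp (perp U) = U"
proof -
  have "card U * card (perp U) = card (perp (perp U)) * card (perp U)"
    using card_perp[OF assms] card_perp[OF subspace_perp, of U] by (simp add: mult.commute)
  then have "card U = card (perp (perp U))"
    using subspace_nonempty_card[OF subspace_perp, of U] by simp
  moreover have "U \<subseteq> perp (perp U)"
    by (auto simp: perp_def form_sym)
  ultimately show ?thesis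
    using finite_space by (metis card_subset_eq)
qed

lemma card_self_perp:
  assumes "subspace U" "perp U = U"
  shows "card U = CARD('a) ^ n"
proof -
  have "card U ^ 2 = (CARD('a) ^ n) ^ 2"
    using card_perp[OF assms(1)] assms(2) by (simp add: power2_eq_square power_add[symmetric] mult_2)
  then show ?thesis
    by simp
qed

text \<open>Since \<open>W \<subseteq> perp W\<close>, the square of \<open>card W\<close> is at
  most \<open>card W * card (perp W)\<close>, the order of the space.\<close>

lemma totally_isotropic_dim_le:
  assumes "totally_isotropic B W"
  shows "dim W \<le> n"
proof -
  have W: "subspace W" "W \<subseteq> perp W"
    using assms by (auto simp: totally_isotropic_iff)
  have "card W * card W \<le> CARD('a) ^ (2 * n)"
    using card_perp[OF W(1)] card_mono[OF finite_space W(2)] by (metis mult_le_mono2)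
  then have "CARD('a) ^ (2 * dim W) \<le> CARD('a) ^ (2 * n)"
    using card_subspace[OF W(1) finite_space] by (simp add: power_add[symmetric] mult_2)
  moreover have "card {0, 1 :: 'a} \<le> CARD('a)"
    by (intro card_mono) auto
  ultimately show ?thesis
    by (simp add: power_increasing_iff)
qed

lemma totally_isotropic_insert:
  assumes "totally_isotropic B W" "v \<in> perp W"
  shows "totally_isotropic B (span (insert v W))"
proof -
  have W: "subspace W" "\<And>x y. x \<in> W \<Longrightarrow> y \<in> W \<Longrightarrow> B x y = 0"
    using assms(1) by (auto simp: totally_isotropic_def)
  have "B w v = 0" "B v w = 0" if "w \<in> W" for w
    using assms(2) that form_sym by (auto simp: perp_def)
  moreover have "span (insert v W) = (\<lambda>(c, y). scale c v + y) ` (UNIV \<times> W)"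
    using W(1) by (simp add: span_insert_eq_image span_eq_iff[THEN iffD2])
  ultimately have "\<forall>x\<in>span (insert v W). \<forall>y\<in>span (insert v W). B x y = 0"
    using W(2) by (auto simp: form_simps)
  then show ?thesis
    by (simp add: totally_isotropic_def)
qed

text \<open>A maximal totally isotropic \<open>L\<close> equals \<open>perp L\<close>. If \<open>R\<close> is maximal among the totally isotropic
  subspaces meeting \<open>L\<close> in 0, then \<open>perp R \<subseteq> L + R\<close>, so \<open>L \<inter> perp R\<close> is orthogonal to \<open>perp R\<close>, hence
  lies in \<open>R\<close> and vanishes; this forces \<open>perp R = R\<close>.\<close>

lemma exists_lagrangian_pair:
  "\<exists>L R. totally_isotropic B L \<and> totally_isotropic B R \<and> L \<inter> R = {0} \<and>
     card L = CARD('a) ^ n \<and> card R = CARD('a) ^ n"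
proof -
  have zero: "totally_isotropic B {0}"
    by (simp add: totally_isotropic_def form_simps)
  have fin: "finite {W. P W}" for P :: "'b set \<Rightarrow> bool"
    using finite_space by (rule finite_subset[rotated, OF iffD2[OF finite_Pow_iff, of UNIV]]) auto
  obtain L where L: "totally_isotropic B L"
    and L_max: "\<And>W. totally_isotropic B W \<Longrightarrow> L \<subseteq> W \<Longrightarrow> L = W"
    using finite_has_maximal[OF fin[of "totally_isotropic B"]] zero by auto
  have L': "subspace L" "L \<subseteq> perp L"
    using L by (auto simp: totally_isotropic_iff)
  have "perp L \<subseteq> L"
  proof
    fix v assume "v \<in> perp L"
    from L_max[OF totally_isotropic_insert[OF L this]] show "v \<in> L"
      by (metis insert_subset span_superset)
  qed
  then have perpL: "perp L = L"
    using L' by auto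
  have "{W. totally_isotropic B W \<and> L \<inter> W = {0}} \<noteq> {}"
    using zero subspace_0[OF L'(1)] by auto
  from finite_has_maximal[OF fin this] obtain R
    where R: "totally_isotropic B R" "L \<inter> R = {0}"
      and R_max: "\<And>W. totally_isotropic B W \<Longrightarrow> L \<inter> W = {0} \<Longrightarrow> R \<subseteq> W \<Longrightarrow> R = W"
    by auto
  have R': "subspace R" "R \<subseteq> perp R"
    using R(1) by (auto simp: totally_isotropic_iff)
  have decomp: "\<exists>x\<in>L. \<exists>y\<in>R. v = x + y" if v: "v \<in> perp R" for v
  proof (cases "v \<in> R")
    case True
    then show ?thesis
      using subspace_0[OF L'(1)] by force
  next
    case False
    then have "span (insert v R) \<noteq> R"
      by (metis insert_subset span_superset)
    \<comment> \<open>By maximality of \<open>R\<close>, the larger isotropic subspace spanned by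
      \<open>v\<close> and \<open>R\<close> meets \<open>L\<close>. A nonzero common vector involves
      \<open>v\<close> because \<open>L\<close> and \<open>R\<close> are disjoint, and solving it
      for \<open>v\<close> gives the decomposition.\<close>
    then have "L \<inter> span (insert v R) \<noteq> {0}"
      using R_max[OF totally_isotropic_insert[OF R(1) v]] span_superset[of "insert v R"] by blast
    then obtain x where x: "x \<in> L" "x \<in> span (insert v R)" "x \<noteq> 0"
      using subspace_0[OF L'(1)] span_zero by blast
    then obtain c y where cy: "y \<in> R" "x = scale c v + y"
      using R'(1) by (auto simp: span_insert_eq_image span_eq_iff[THEN iffD2])
    have "c \<noteq> 0"
    proof
      assume "c = 0"
      then have "x \<in> L \<inter> R"
        using x(1) cy by simp
      then show False
        using x(3) R(2) by blast
    qed
    then have "v = scale (inverse c) x + scale (- inverse c) y"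
      by (simp add: cy(2) scale_right_distrib)
    then show ?thesis
      using x(1) cy(1) L'(1) R'(1) subspace_scale by blast
  qed
  have "L \<inter> perp R \<subseteq> perp (perp R)"
  proof
    fix x assume x: "x \<in> L \<inter> perp R"
    show "x \<in> perp (perp R)"
      unfolding perp_def[of "perp R"]
    proof (clarify)
      fix v assume "v \<in> perp R"
      then obtain x' y where "x' \<in> L" "y \<in> R" "v = x' + y"
        using decomp by blast
      then show "B v x = 0"
        using x L by (simp add: form_simps totally_isotropic_def perp_def)
    qed
  qed
  then have disj: "L \<inter> perp R \<subseteq> {0}"
    using perp_perp[OF R'(1)] R(2) by auto
  have "perp R \<subseteq> R"
  proof
    fix v assume v: "v \<in> perp R"
    then obtain x y where xy: "x \<in> L" "y \<in> R" "v = x + y"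
      using decomp by blast
    then have "x = v - y"
      by simp
    then have "x \<in> perp R"
      using v xy(2) R'(2) subspace_diff[OF subspace_perp] by blast
    then show "v \<in> R"
      using disj xy by auto
  qed
  then have "perp R = R"
    using R' by auto
  then show ?thesis
    using L R L' R' perpL card_self_perp by blast
qed

text \<open>\<open>\<alpha>\<close> is any linear isomorphism from \<open>M\<close> onto a
  lagrangian \<open>L\<close>. On a complementary lagrangian \<open>R\<close>, the vector
  \<open>\<beta> w\<close> is the one whose pairing with \<open>L\<close> represents
  \<open>ip _ w\<close>; its uniqueness makes \<open>\<beta>\<close> linear, and counting gives
  surjectivity.\<close>

lemma exists_hyperbolic_coordinates:
  fixes sM :: "'a \<Rightarrow> 'm::ab_group_add \<Rightarrow> 'm" and M :: "'m set" and ip :: "'m \<Rightarrow> 'm \<Rightarrow> 'a"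
  assumes "vector_space sM" and M: "module.subspace sM M" "card M = CARD('a) ^ n"
    and ip: "\<And>u v w. ip (u + v) w = ip u w + ip v w" "\<And>u v w. ip u (v + w) = ip u v + ip u w"
      "\<And>c u w. ip (sM c u) w = c * ip u w" "\<And>c u w. ip u (sM c w) = c * ip u w"
    and nondeg: "\<And>w. w \<in> M \<Longrightarrow> w \<noteq> 0 \<Longrightarrow> \<exists>u\<in>M. ip u w \<noteq> 0"
  shows "\<exists>\<alpha> \<beta>. (\<forall>u\<in>M. \<forall>w\<in>M. \<alpha> (u + w) = \<alpha> u + \<alpha> w \<and> \<beta> (u + w) = \<beta> u + \<beta> w) \<and>
     (\<forall>c. \<forall>u\<in>M. \<alpha> (sM c u) = scale c (\<alpha> u) \<and> \<beta> (sM c u) = scale c (\<beta> u)) \<and>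
     (\<forall>u\<in>M. \<forall>w\<in>M. B (\<alpha> u) (\<alpha> w) = 0 \<and> B (\<beta> u) (\<beta> w) = 0 \<and> B (\<alpha> u) (\<beta> w) = ip u w) \<and>
     bij_betw (\<lambda>(u, w). \<alpha> u + \<beta> w) (M \<times> M) UNIV"
proof -
  interpret m: finite_field_space sM
    using assms(1) by (simp add: finite_field_space_def)
  obtain L R where L: "totally_isotropic B L" "card L = CARD('a) ^ n"
    and R: "totally_isotropic B R" "card R = CARD('a) ^ n" and LR: "L \<inter> R = {0}"
    using exists_lagrangian_pair by blast
  have sL: "subspace L" and sR: "subspace R"
    using L R by (auto simp: totally_isotropic_def)
  have self: "perp L = L" "perp R = R"
  proof -
    have "perp U = U" if U: "totally_isotropic B U" "card U = CARD('a) ^ n" for U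
    proof -
      have "CARD('a) ^ n * card (perp U) = CARD('a) ^ n * card U"
        using card_perp[of U] U by (simp add: totally_isotropic_def mult_2 power_add)
      then have "card (perp U) = card U"
        by simp
      then show ?thesis
        using U card_subset_eq[OF finite_space] by (metis totally_isotropic_iff)
    qed
    then show "perp L = L" "perp R = R"
      using L R by auto
  qed
  have finM: "finite M"
    using M(2) by (intro card_ge_0_finite) simp
  have decomp: "\<exists>x\<in>L. \<exists>y\<in>R. v = x + y" for v
  proof -
    have "inj_on (\<lambda>(x, y). x + y) (L \<times> R)"
    proof (clarsimp simp: inj_on_def)
      fix x y x' y' assume *: "x \<in> L" "x' \<in> L" "y \<in> R" "y' \<in> R" "x + y = x' + y'"
      then have "x - x' = y' - y"
        by (simp add: algebra_simps)
      then have "x - x' \<in> L \<inter> R"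
        using * sL sR subspace_diff by (metis IntI)
      then show "x = x' \<and> y = y'"
        using LR * by auto
    qed
    then have "card ((\<lambda>(x, y). x + y) ` (L \<times> R)) = card (UNIV :: 'b set)"
      using L R by (simp add: card_image card_cartesian_product card_UNIV_space mult_2 power_add)
    then have "(\<lambda>(x, y). x + y) ` (L \<times> R) = UNIV"
      by (intro card_subset_eq[OF finite_space]) auto
    then have "v \<in> (\<lambda>(x, y). x + y) ` (L \<times> R)"
      by simp
    then show ?thesis
      by auto
  qed
  interpret pair: vector_space_pair sM scale ..
  obtain C where C: "C \<subseteq> M" "m.independent C" "M \<subseteq> m.span C" "card C = m.dim M"
    by (rule m.basis_exists)
  obtain D where D: "D \<subseteq> L" "independent D" "L \<subseteq> span D" "card D = dim L"
    by (rule basis_exists)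
  have "m.dim M = dim L"
    using m.dim_subspace_eq[OF M(1) finM M(2)] dim_eq_if_card[OF sL L(2)] by simp
  from pair.finite_basis_to_basis_subspace_isomorphism[OF M(1) sL this
      finite_subset[OF C(1) finM] C finite_space D]
  obtain \<alpha> where \<alpha>: "Vector_Spaces.linear sM scale \<alpha>" "\<alpha> ` M = L" "inj_on \<alpha> M"
    by blast
  interpret \<alpha>: Vector_Spaces.linear sM scale \<alpha>
    by (rule \<alpha>(1))
  \<comment> \<open>Two vectors of \<open>R\<close> with the same pairings against \<open>L\<close>
    differ by an element of \<open>perp L \<inter> R = L \<inter> R\<close>.\<close>
  have unique: "y = y'" if "y \<in> R" "y' \<in> R" "\<forall>u\<in>M. B (\<alpha> u) y = B (\<alpha> u) y'" for y y'
  proof -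
    have "y - y' \<in> perp L"
      using that(3) \<alpha>(2) by (auto simp: perp_def form_simps)
    moreover have "y - y' \<in> R"
      using that sR subspace_diff by blast
    ultimately have "y - y' \<in> {0}"
      using LR self by blast
    then show ?thesis
      by simp
  qed
  have "\<exists>y\<in>R. \<forall>u\<in>M. B (\<alpha> u) y = ip u w" if w: "w \<in> M" for w
  proof (cases "w = 0")
    case True
    have "ip u 0 = 0" for u
      using ip(4)[of u 0 0] by simp
    then show ?thesis
      using True subspace_0[OF sR] by (intro bexI[of _ 0]) (simp_all add: form_simps)
  next
    case False
    \<comment> \<open>\<open>N\<close> corresponds to the kernel of \<open>ip _ w\<close>. It is a
      proper subspace of \<open>L\<close>, so \<open>perp N\<close> is strictly larger than
      \<open>perp L\<close>. The \<open>R\<close>-component \<open>y\<close> of an extra vector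
      pairs to 0 with the kernel but not with all of \<open>L\<close>; such a functional is a
      multiple of \<open>ip _ w\<close>, and \<open>t\<close> is the factor that corrects
      it.\<close>
    define N where "N = \<alpha> ` {u\<in>M. ip u w = 0}"
    have "N \<subseteq> L"
      using \<alpha>(2) by (auto simp: N_def)
    have ip0: "ip 0 w = 0"
      using ip(3)[of 0 0 w] by simp
    have "m.subspace {u\<in>M. ip u w = 0}"
      using M(1) ip0 by (auto simp: m.subspace_def ip)
    then have sN: "subspace N"
      unfolding N_def by (rule \<alpha>.subspace_image)
    obtain u1 where "u1 \<in> M" "ip u1 w \<noteq> 0"
      using nondeg[OF w False] by blast
    then have "\<alpha> u1 \<in> L" "\<alpha> u1 \<notin> N"
      using \<alpha>(2,3) by (auto simp: N_def inj_on_def)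
    then have "N \<noteq> L"
      by blast
    have "perp N \<noteq> perp L"
      using perp_perp[OF sN] perp_perp[OF sL] \<open>N \<noteq> L\<close> by metis
    then obtain v where v: "v \<in> perp N" "v \<notin> L"
      using perp_mono[OF \<open>N \<subseteq> L\<close>] self(1) by auto
    obtain x y where xy: "x \<in> L" "y \<in> R" "v = x + y"
      using decomp by blast
    then have "y = v - x"
      by simp
    then have "y \<in> perp N"
      using v(1) xy(1) perp_mono[OF \<open>N \<subseteq> L\<close>] self(1) subspace_diff[OF subspace_perp] by blast
    moreover have "y \<notin> perp L"
      using v(2) xy sL self(1) subspace_add by blast
    ultimately obtain u0 where u0: "u0 \<in> M" "B (\<alpha> u0) y \<noteq> 0" and
      N0: "\<And>u. u \<in> M \<Longrightarrow> ip u w = 0 \<Longrightarrow> B (\<alpha> u) y = 0"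
      unfolding perp_def N_def \<alpha>(2)[symmetric] by blast
    have ip_u0: "ip u0 w \<noteq> 0"
      using u0 N0 by blast
    define t where "t = ip u0 w / B (\<alpha> u0) y"
    have "B (\<alpha> u) (scale t y) = ip u w" if u: "u \<in> M" for u
    proof -
      \<comment> \<open>With this \<open>s\<close> the vector \<open>u - sM s u0\<close> lies in the
        kernel of \<open>ip _ w\<close>.\<close>
      define s where "s = ip u w / ip u0 w"
      have diff: "u - sM s u0 \<in> M"
        using u u0 M(1) m.subspace_diff m.subspace_scale by blast
      have "ip (u - sM s u0) w + ip (sM s u0) w = ip u w"
        by (simp flip: ip(1))
      then have "ip (u - sM s u0) w = 0"
        using ip_u0 by (simp add: ip s_def)
      from N0[OF diff this] have "B (\<alpha> u) y = s * B (\<alpha> u0) y"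
        by (simp add: \<alpha>.diff \<alpha>.scale form_simps)
      then show ?thesis
        using u0 ip_u0 by (simp add: form_simps t_def s_def)
    qed
    then show ?thesis
      using xy(2) sR subspace_scale by blast
  qed
  then obtain \<beta> where \<beta>: "\<And>w. w \<in> M \<Longrightarrow> \<beta> w \<in> R" "\<And>u w. u \<in> M \<Longrightarrow> w \<in> M \<Longrightarrow> B (\<alpha> u) (\<beta> w) = ip u w"
    by metis
  have M_add: "u + w \<in> M" if "u \<in> M" "w \<in> M" for u w
    using that M(1) m.subspace_add by blast
  have M_diff: "u - w \<in> M" if "u \<in> M" "w \<in> M" for u w
    using that M(1) m.subspace_diff by blast
  have M_scale: "sM c u \<in> M" if "u \<in> M" for c u
    using that M(1) m.subspace_scale by blast
  have \<beta>_add: "\<beta> (u + w) = \<beta> u + \<beta> w" if "u \<in> M" "w \<in> M" for u w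
    using that M_add sR by (intro unique) (auto simp: \<beta> form_simps ip subspace_add)
  have \<beta>_scale: "\<beta> (sM c u) = scale c (\<beta> u)" if "u \<in> M" for c u
    using that M_scale sR by (intro unique) (auto simp: \<beta> form_simps ip subspace_scale)
  have inj: "inj_on (\<lambda>(u, w). \<alpha> u + \<beta> w) (M \<times> M)"
  proof (clarsimp simp: inj_on_def)
    fix u w u' w' assume *: "u \<in> M" "u' \<in> M" "w \<in> M" "w' \<in> M" "\<alpha> u + \<beta> w = \<alpha> u' + \<beta> w'"
    then have "\<alpha> u - \<alpha> u' = \<beta> w' - \<beta> w"
      by (simp add: algebra_simps)
    moreover have "\<alpha> u - \<alpha> u' \<in> L" "\<beta> w' - \<beta> w \<in> R"
      using * \<alpha>(2) \<beta>(1) sL sR subspace_diff by blast+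
    ultimately have "\<alpha> u - \<alpha> u' \<in> {0}" "\<beta> w' - \<beta> w \<in> {0}"
      using LR by (metis IntI)+
    then have 0: "\<alpha> u = \<alpha> u'" "\<beta> w = \<beta> w'"
      by auto
    have "w - w' = 0"
    proof (rule ccontr)
      assume "w - w' \<noteq> 0"
      then obtain v where v: "v \<in> M" "ip v (w - w') \<noteq> 0"
        using nondeg M_diff * by blast
      have "ip v w = ip v w'"
        using \<beta>(2)[OF v(1)] * 0(2) by metis
      moreover have "ip v (w - w') + ip v w' = ip v w"
        by (simp flip: ip(2))
      ultimately show False
        using v(2) by simp
    qed
    then show "u = u' \<and> w = w'"
      using 0(1) \<alpha>(3) * by (auto simp: inj_on_def)
  qed
  then have "card ((\<lambda>(u, w). \<alpha> u + \<beta> w) ` (M \<times> M)) = card (UNIV :: 'b set)"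
    using M(2) by (simp add: card_image card_cartesian_product card_UNIV_space mult_2 power_add)
  then have surj: "(\<lambda>(u, w). \<alpha> u + \<beta> w) ` (M \<times> M) = UNIV"
    by (intro card_subset_eq[OF finite_space]) auto
  have "B (\<alpha> u) (\<alpha> w) = 0 \<and> B (\<beta> u) (\<beta> w) = 0" if "u \<in> M" "w \<in> M" for u w
    using that L(1) R(1) \<alpha>(2) \<beta>(1) by (auto simp: totally_isotropic_def)
  then show ?thesis
    using \<beta>(2) \<beta>_add \<beta>_scale inj surj
    by (intro exI[of _ \<alpha>] exI[of _ \<beta>]) (auto simp: bij_betw_def \<alpha>.add \<alpha>.scale)
qed

end

subsection \<open>Spreads from symmetric matrices\<close>

context char_2_sp_space
begin

section \<open>Criteria for maximality and for plus type\<close>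

text \<open>A new member of a larger partial spread would have to meet every old member only in
  0.\<close>

lemma maximal_symplectic_partial_spreadI:
  assumes "symplectic_partial_spread B n S"
    and "\<And>W. totally_isotropic B W \<Longrightarrow> dim W = n \<Longrightarrow> \<exists>U\<in>S. W \<inter> U \<noteq> {0}"
  shows "maximal_symplectic_partial_spread B n S"
  unfolding maximal_symplectic_partial_spread_def
proof (intro conjI notI assms(1))
  assume "\<exists>T. symplectic_partial_spread B n T \<and> S \<subset> T"
  then obtain T W where T: "symplectic_partial_spread B n T" "S \<subset> T" "W \<in> T" "W \<notin> S"
    by blast
  then obtain U where "U \<in> S" "W \<inter> U \<noteq> {0}"
    using assms(2)[of W] by (auto simp: symplectic_partial_spread_def)
  moreover have "U \<in> T" "W \<noteq> U"
    using T \<open>U \<in> S\<close> by auto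
  ultimately show False
    using T by (simp add: symplectic_partial_spread_def)
qed

lemma totally_singular_isotropic:
  assumes "polar_form Q = B" "totally_singular Q W"
  shows "totally_isotropic B W"
  using assms subspace_add
  by (fastforce simp: totally_singular_def totally_isotropic_def polar_form_def fun_eq_iff)

text \<open>Every orthogonal partial spread is a symplectic one, so an orthogonal extension of
  \<open>S\<close> would be a symplectic extension.\<close>

lemma maximal_orthogonal_if_maximal_symplectic:
  assumes "maximal_symplectic_partial_spread B n S" "polar_form Q = B"
    and "\<And>W. W \<in> S \<Longrightarrow> totally_singular Q W"
  shows "maximal_orthogonal_partial_spread Q n S"
proof -
  have "symplectic_partial_spread B n T" if "orthogonal_partial_spread Q n T" for T
    using that totally_singular_isotropic[OF assms(2)]
    by (auto simp: orthogonal_partial_spread_def symplectic_partial_spread_def)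
  moreover have "orthogonal_partial_spread Q n S"
    using assms(1,3) by (auto simp: maximal_symplectic_partial_spread_def
        orthogonal_partial_spread_def symplectic_partial_spread_def)
  ultimately show ?thesis
    using assms(1)
    unfolding maximal_symplectic_partial_spread_def maximal_orthogonal_partial_spread_def by blast
qed

text \<open>Totally singular subspaces are totally isotropic, which bounds the Witt index by
  \<open>n\<close>; the given \<open>W\<close> attains the bound.\<close>

lemma plus_typeI:
  assumes "polar_form Q = B" "\<And>c x. Q (scale c x) = c\<^sup>2 * Q x"
    and "totally_singular Q W" "dim W = n"
  shows "plus_type Q"
proof -
  have "Max {dim W | W. totally_singular Q W} = n"
  proof (rule Max_eqI)
    show le: "d \<le> n" if "d \<in> {dim W | W. totally_singular Q W}" for d
      using that totally_isotropic_dim_le totally_singular_isotropic[OF assms(1)] by auto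
    show "finite {dim W | W. totally_singular Q W}"
      by (rule finite_subset[OF subsetI finite_atMost[of n]]) (simp only: atMost_iff le)
    show "n \<in> {dim W | W. totally_singular Q W}"
      using assms(3,4) by auto
  qed
  then show ?thesis
    using assms(1,2) alternating nondegenerate dim_space
    by (simp add: plus_type_def witt_index_def quadratic_form_def alternating_form_def)
qed

end

section \<open>Coordinates over the extension field\<close>

text \<open>\<open>K\<close> and \<open>ip\<close> are parameters determined by \<open>K_def\<close>
  and \<open>ip_def\<close>, so that the remaining assumptions can be written in terms of
  them.\<close>

locale ext_field_coordinates = char_2_sp_space scale B "2 * k"
  for scale :: "'a::{field,finite} \<Rightarrow> 'b::ab_group_add \<Rightarrow> 'b" and B k +
  fixes f :: "'a alg_closure \<Rightarrow> 'a"
    and \<alpha> \<beta> :: "'a alg_closure \<times> 'a alg_closure \<Rightarrow> 'b"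
    and K :: "'a alg_closure set"
    and ip :: "'a alg_closure \<times> 'a alg_closure \<Rightarrow> 'a alg_closure \<times> 'a alg_closure \<Rightarrow> 'a"
  assumes k: "k \<ge> 1"
    and f_add: "f (x + y) = f x + f y"
    and f_scale: "f (to_ac c * x) = c * f x"
    and f_1: "f 1 = 1"
    and K_def: "K = ext_field k"
    and ip_def: "ip u w = f (fst u * fst w + snd u * snd w)"
    and \<alpha>_add: "u \<in> K \<times> K \<Longrightarrow> w \<in> K \<times> K \<Longrightarrow> \<alpha> (u + w) = \<alpha> u + \<alpha> w"
    and \<beta>_add: "u \<in> K \<times> K \<Longrightarrow> w \<in> K \<times> K \<Longrightarrow> \<beta> (u + w) = \<beta> u + \<beta> w"
    and \<alpha>_scale: "u \<in> K \<times> K \<Longrightarrow> \<alpha> (to_ac c * fst u, to_ac c * snd u) = scale c (\<alpha> u)"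
    and \<beta>_scale: "u \<in> K \<times> K \<Longrightarrow> \<beta> (to_ac c * fst u, to_ac c * snd u) = scale c (\<beta> u)"
    and form_\<alpha>: "u \<in> K \<times> K \<Longrightarrow> w \<in> K \<times> K \<Longrightarrow> B (\<alpha> u) (\<alpha> w) = 0"
    and form_\<beta>: "u \<in> K \<times> K \<Longrightarrow> w \<in> K \<times> K \<Longrightarrow> B (\<beta> u) (\<beta> w) = 0"
    and form_\<alpha>\<beta>: "u \<in> K \<times> K \<Longrightarrow> w \<in> K \<times> K \<Longrightarrow> B (\<alpha> u) (\<beta> w) = ip u w"
    and coordinates: "bij_betw (\<lambda>(u, w). \<alpha> u + \<beta> w) ((K \<times> K) \<times> (K \<times> K)) UNIV"
begin

lemma ac_add_self: "x + x = (0 :: 'a alg_closure)"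
proof -
  have "x + x = to_ac (1 + 1) * x"
    by (simp only: to_ac_add to_ac_1 distrib_right mult_1_left)
  then show ?thesis
    by (simp only: one_add_one_eq_0 to_ac_0 mult_zero_left)
qed

lemma ac_add_eq_0_iff: "x + y = 0 \<longleftrightarrow> x = (y :: 'a alg_closure)"
  using ac_add_self[of y] by (metis add_right_cancel)

lemma ac_minus: "- x = (x :: 'a alg_closure)" "x - y = (x + y :: 'a alg_closure)"
  using ac_add_self[of x] ac_add_self[of y] by (simp_all add: minus_unique diff_eq_eq add.assoc)

lemma K_simps [simp]:
  "0 \<in> K" "1 \<in> K" "to_ac c \<in> K"
  "x \<in> K \<Longrightarrow> y \<in> K \<Longrightarrow> x + y \<in> K" "x \<in> K \<Longrightarrow> y \<in> K \<Longrightarrow> x - y \<in> K"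
  "x \<in> K \<Longrightarrow> y \<in> K \<Longrightarrow> x * y \<in> K"
  "x \<in> K \<Longrightarrow> inverse x \<in> K" "x \<in> K \<Longrightarrow> y \<in> K \<Longrightarrow> x / y \<in> K" "x \<in> K \<Longrightarrow> x\<^sup>2 \<in> K"
  by (simp_all add: K_def ext_field_basic ext_field_add[OF one_add_one_eq_0] ac_minus power2_eq_square)

lemma card_K: "card K = CARD('a) ^ k"
  using card_ext_field[OF one_add_one_eq_0 k] by (simp add: K_def)

lemma finite_K: "finite K"
  using card_K by (intro card_ge_0_finite) simp

lemma card_KK: "card (K \<times> K) = CARD('a) ^ (2 * k)"
  by (simp add: card_cartesian_product card_K mult_2 power_add)

lemma coordinates_eq:
  assumes "u \<in> K \<times> K" "w \<in> K \<times> K" "u' \<in> K \<times> K" "w' \<in> K \<times> K"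
  shows "\<alpha> u + \<beta> w = \<alpha> u' + \<beta> w' \<longleftrightarrow> u = u' \<and> w = w'"
  using assms inj_onD[OF bij_betw_imp_inj_on[OF coordinates], of "(u, w)" "(u', w')"] by auto

lemma coordinates_exist: "\<exists>u\<in>K \<times> K. \<exists>w\<in>K \<times> K. v = \<alpha> u + \<beta> w"
proof -
  have "v \<in> (\<lambda>(u, w). \<alpha> u + \<beta> w) ` ((K \<times> K) \<times> (K \<times> K))"
    using coordinates by (simp add: bij_betw_def)
  then obtain p where "p \<in> (K \<times> K) \<times> (K \<times> K)" "v = (\<lambda>(u, w). \<alpha> u + \<beta> w) p"
    by (elim imageE)
  then show ?thesis
    by (intro bexI[of _ "fst p"] bexI[of _ "snd p"]) (simp_all add: split_beta mem_Times_iff)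
qed

lemma KK_0: "0 \<in> K \<times> K"
  by (simp add: zero_prod_def)

lemma KK_add: "u \<in> K \<times> K \<Longrightarrow> w \<in> K \<times> K \<Longrightarrow> u + w \<in> K \<times> K"
  by (auto simp: plus_prod_def)

lemma \<alpha>\<beta>_0: "\<alpha> 0 = 0" "\<beta> 0 = 0"
  using \<alpha>_add[of 0 0] \<beta>_add[of 0 0] KK_0 by simp_all

lemma form_coordinates:
  assumes "u \<in> K \<times> K" "w \<in> K \<times> K" "u' \<in> K \<times> K" "w' \<in> K \<times> K"
  shows "B (\<alpha> u + \<beta> w) (\<alpha> u' + \<beta> w') = ip u w' + ip u' w"
  using assms form_sym[of "\<beta> w" "\<alpha> u'"] by (simp add: form_simps form_\<alpha> form_\<beta> form_\<alpha>\<beta>)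

lemma ip_simps:
  "ip (u + v) w = ip u w + ip v w" "ip u (v + w) = ip u v + ip u w" "ip u w = ip w u"
  by (simp_all add: ip_def f_add[symmetric] algebra_simps)

section \<open>The members of the spreads and their intersections\<close>

definition infinity_space :: "'b set" where
  "infinity_space = \<beta> ` (K \<times> K)"

text \<open>The triple \<open>(p, r, s)\<close> stands for the symmetric matrix with rows \<open>(p, r)\<close> and \<open>(r, s)\<close>.\<close>

fun sym_map where
  "sym_map (p, r, s) (x, y) = (p * x + r * y, r * x + s * (y :: 'a alg_closure))"

definition graph_space where
  "graph_space m = (\<lambda>u. \<alpha> u + \<beta> (sym_map m u)) ` (K \<times> K)"

lemma sym_map_simps:
  "m \<in> K \<times> K \<times> K \<Longrightarrow> u \<in> K \<times> K \<Longrightarrow> sym_map m u \<in> K \<times> K"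
  "sym_map m (u + w) = sym_map m u + sym_map m w"
  "sym_map m (c * fst u, c * snd u) = (c * fst (sym_map m u), c * snd (sym_map m u))"
  "ip u (sym_map m w) = ip (sym_map m u) w"
  by (cases m; cases u; cases w; auto simp: ip_def algebra_simps)+

lemma infinity_space_isotropic:
  "totally_isotropic B infinity_space" "card infinity_space = CARD('a) ^ (2 * k)"
proof -
  have "subspace infinity_space"
    unfolding infinity_space_def
  proof (rule subspaceI)
    show "0 \<in> \<beta> ` (K \<times> K)"
      using KK_0 \<alpha>\<beta>_0 by (metis imageI)
    show "x + y \<in> \<beta> ` (K \<times> K)" if xy: "x \<in> \<beta> ` (K \<times> K)" "y \<in> \<beta> ` (K \<times> K)" for x y
    proof -
      obtain u w where "u \<in> K \<times> K" "w \<in> K \<times> K" "x = \<beta> u" "y = \<beta> w"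
        using xy by (elim imageE)
      then show ?thesis
        using KK_add \<beta>_add by (intro image_eqI[of _ _ "u + w"]) simp_all
    qed
    show "scale c x \<in> \<beta> ` (K \<times> K)" if "x \<in> \<beta> ` (K \<times> K)" for c x
    proof -
      from that obtain u where "u \<in> K \<times> K" "x = \<beta> u"
        by (elim imageE)
      then show ?thesis
        using \<beta>_scale[of u c] by (intro image_eqI[of _ _ "(to_ac c * fst u, to_ac c * snd u)"]) auto
    qed
  qed
  then show "totally_isotropic B infinity_space"
    by (auto simp: totally_isotropic_def infinity_space_def form_\<beta>)
  have "inj_on \<beta> (K \<times> K)"
    using coordinates_eq[OF KK_0 _ KK_0] by (simp add: inj_on_def)
  then show "card infinity_space = CARD('a) ^ (2 * k)"
    unfolding infinity_space_def by (simp only: card_image card_KK)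
qed

text \<open>Symmetry of the matrix makes the two terms of \<open>form_coordinates\<close> equal, so
  they cancel in characteristic 2.\<close>

lemma graph_space_isotropic:
  assumes m: "m \<in> K \<times> K \<times> K"
  shows "totally_isotropic B (graph_space m)" "card (graph_space m) = CARD('a) ^ (2 * k)"
proof -
  let ?g = "\<lambda>u. \<alpha> u + \<beta> (sym_map m u)"
  note S = sym_map_simps(1)[OF m]
  have 0: "sym_map m 0 = 0"
    by (cases m) (simp add: zero_prod_def)
  have "subspace (graph_space m)"
    unfolding graph_space_def
  proof (rule subspaceI)
    show "0 \<in> ?g ` (K \<times> K)"
      using KK_0 by (intro image_eqI[of _ _ 0]) (simp_all add: 0 \<alpha>\<beta>_0)
    show "x + y \<in> ?g ` (K \<times> K)" if xy: "x \<in> ?g ` (K \<times> K)" "y \<in> ?g ` (K \<times> K)" for x y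
    proof -
      obtain u w where "u \<in> K \<times> K" "w \<in> K \<times> K" "x = ?g u" "y = ?g w"
        using xy by (elim imageE)
      then show ?thesis
        using KK_add S by (intro image_eqI[of _ _ "u + w"]) (simp_all add: \<alpha>_add \<beta>_add sym_map_simps(2))
    qed
    show "scale c x \<in> ?g ` (K \<times> K)" if x: "x \<in> ?g ` (K \<times> K)" for c x
    proof -
      obtain u where u: "u \<in> K \<times> K" "x = ?g u"
        using x by (elim imageE)
      then have "scale c x = ?g (to_ac c * fst u, to_ac c * snd u)"
        using \<alpha>_scale[OF u(1), of c] \<beta>_scale[OF S[OF u(1)], of c]
        by (simp only: sym_map_simps(3) scale_right_distrib)
      moreover have "(to_ac c * fst u, to_ac c * snd u) \<in> K \<times> K"
        using u(1) by auto
      ultimately show ?thesis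
        by blast
    qed
  qed
  moreover have "B (?g u) (?g w) = 0" if "u \<in> K \<times> K" "w \<in> K \<times> K" for u w
  proof -
    have "B (?g u) (?g w) = ip u (sym_map m w) + ip w (sym_map m u)"
      using that S by (intro form_coordinates)
    also have "ip w (sym_map m u) = ip u (sym_map m w)"
      by (metis sym_map_simps(4) ip_simps(3))
    finally show ?thesis
      by (simp only: add_self)
  qed
  ultimately show "totally_isotropic B (graph_space m)"
    unfolding totally_isotropic_def graph_space_def by blast
  have "inj_on ?g (K \<times> K)"
  proof (rule inj_onI)
    fix u w assume "u \<in> K \<times> K" "w \<in> K \<times> K" "?g u = ?g w"
    then show "u = w"
      using coordinates_eq[of u "sym_map m u" w "sym_map m w"] S by simp
  qed
  then show "card (graph_space m) = CARD('a) ^ (2 * k)"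
    unfolding graph_space_def by (simp only: card_image card_KK)
qed

lemma infinity_inter_graph:
  assumes m: "m \<in> K \<times> K \<times> K"
  shows "infinity_space \<inter> graph_space m \<subseteq> {0}"
proof
  fix v assume "v \<in> infinity_space \<inter> graph_space m"
  then obtain u w where uw: "u \<in> K \<times> K" "w \<in> K \<times> K" "v = \<alpha> u + \<beta> (sym_map m u)" "v = \<alpha> 0 + \<beta> w"
    by (auto simp: infinity_space_def graph_space_def \<alpha>\<beta>_0)
  then have "u = 0" "sym_map m u = w"
    using coordinates_eq[OF uw(1) sym_map_simps(1)[OF m uw(1)] KK_0 uw(2)] by auto
  moreover have "sym_map m 0 = 0"
    by (cases m) (simp add: zero_prod_def)
  ultimately show "v \<in> {0}"
    using uw by (simp add: \<alpha>\<beta>_0)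
qed

text \<open>A common vector comes from some \<open>u\<close> on which both matrices agree, that is,
  from the kernel of their difference, and the determinant of that difference is nonzero.\<close>

lemma graph_inter_graph:
  assumes m: "(p, r, s) \<in> K \<times> K \<times> K" "(p', r', s') \<in> K \<times> K \<times> K"
    and det: "(p + p') * (s + s') \<noteq> (r + r')\<^sup>2"
  shows "graph_space (p, r, s) \<inter> graph_space (p', r', s') \<subseteq> {0}"
proof
  fix v assume "v \<in> graph_space (p, r, s) \<inter> graph_space (p', r', s')"
  then obtain u u' where uu: "u \<in> K \<times> K" "u' \<in> K \<times> K"
    "v = \<alpha> u + \<beta> (sym_map (p, r, s) u)" "v = \<alpha> u' + \<beta> (sym_map (p', r', s') u')"
    by (auto simp: graph_space_def)
  then have eq: "u = u'" "sym_map (p, r, s) u = sym_map (p', r', s') u"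
    using coordinates_eq[OF uu(1) sym_map_simps(1)[OF m(1) uu(1)] uu(2)
        sym_map_simps(1)[OF m(2) uu(2)]] by auto
  obtain x y where xy: "u = (x, y)"
    by (cases u)
  have "(p + p') * x + (r + r') * y = (p * x + r * y) + (p' * x + r' * y)"
    "(r + r') * x + (s + s') * y = (r * x + s * y) + (r' * x + s' * y)"
    by (simp_all add: algebra_simps)
  then have 1: "(p + p') * x + (r + r') * y = 0" and 2: "(r + r') * x + (s + s') * y = 0"
    using eq(2) by (simp_all add: xy ac_add_self)
  have "((p + p') * (s + s') - (r + r')\<^sup>2) * x = 0" "((p + p') * (s + s') - (r + r')\<^sup>2) * y = 0"
  proof -
    \<comment> \<open>Multiplication by the adjugate matrix.\<close>
    have "(A * D - C\<^sup>2) * x = D * (A * x + C * y) - C * (C * x + D * y)"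
      "(A * D - C\<^sup>2) * y = A * (C * x + D * y) - C * (A * x + C * y)" for A C D
      by (simp_all add: power2_eq_square algebra_simps)
    then show "((p + p') * (s + s') - (r + r')\<^sup>2) * x = 0"
      "((p + p') * (s + s') - (r + r')\<^sup>2) * y = 0"
      by (simp_all only: 1 2 mult_zero_right diff_0_right)
  qed
  then have "u = 0"
    using det by (simp add: xy zero_prod_def)
  moreover have "sym_map (p, r, s) 0 = 0"
    by (simp add: zero_prod_def)
  ultimately show "v \<in> {0}"
    using uu by (simp add: \<alpha>\<beta>_0)
qed

definition spread_of where
  "spread_of N = insert infinity_space (graph_space ` N)"

text \<open>The inequality says that the difference of two of the symmetric matrices has nonzero
  determinant; in characteristic 2 the difference is written as a sum.\<close>

definition nonsingular_differences where
  "nonsingular_differences N \<longleftrightarrow> N \<subseteq> K \<times> K \<times> K \<and>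
     (\<forall>p r s p' r' s'. (p, r, s) \<in> N \<longrightarrow> (p', r', s') \<in> N \<longrightarrow> (p, r, s) \<noteq> (p', r', s') \<longrightarrow>
       (p + p') * (s + s') \<noteq> (r + r')\<^sup>2)"

lemma spread_of:
  assumes N: "nonsingular_differences N"
  shows "symplectic_partial_spread B (2 * k) (spread_of N)" "card (spread_of N) = card N + 1"
proof -
  have NK: "m \<in> K \<times> K \<times> K" if "m \<in> N" for m
    using that N by (auto simp: nonsingular_differences_def)
  have gg: "graph_space m \<inter> graph_space m' \<subseteq> {0}" if "m \<in> N" "m' \<in> N" "m \<noteq> m'" for m m'
  proof -
    obtain p r s p' r' s' where [simp]: "m = (p, r, s)" "m' = (p', r', s')"
      using prod_cases3 by metis
    show ?thesis
      unfolding \<open>m = _\<close> \<open>m' = _\<close> using that NK[of m] NK[of m'] N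
      by (intro graph_inter_graph) (unfold nonsingular_differences_def, auto)
  qed
  have ig: "infinity_space \<inter> graph_space m \<subseteq> {0}" if "m \<in> N" for m
    using infinity_inter_graph NK that by blast
  have ti: "totally_isotropic B W \<and> card W = CARD('a) ^ (2 * k)" if "W \<in> spread_of N" for W
    using that NK infinity_space_isotropic graph_space_isotropic by (auto simp: spread_of_def)
  have sub: "subspace W" if "W \<in> spread_of N" for W
    using ti[OF that] by (simp add: totally_isotropic_def)
  have inter: "W \<inter> W' = {0}" if W: "W \<in> spread_of N" "W' \<in> spread_of N" "W \<noteq> W'" for W W'
  proof -
    have "W \<inter> W' \<subseteq> {0}"
      using W gg ig unfolding spread_of_def by blast
    then show ?thesis
      using sub W subspace_0 by blast
  qed
  then show "symplectic_partial_spread B (2 * k) (spread_of N)"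
    using ti sub dim_eq_if_card by (simp add: symplectic_partial_spread_def)
  have "card {0, 1 :: 'a} \<le> CARD('a)"
    by (intro card_mono) auto
  then have "CARD('a) ^ (2 * k) > 1"
    using k by (intro one_less_power) auto
  \<comment> \<open>Members are nonzero spaces, so spaces that meet only in 0 are distinct. This
    makes the count of members exact.\<close>
  then have big: "\<not> W \<subseteq> {0}" if "W \<in> spread_of N" for W
    using ti[OF that] card_mono[of "{0}" W] by auto
  have "inj_on graph_space N"
  proof (rule inj_onI, rule ccontr)
    fix m m' assume "m \<in> N" "m' \<in> N" "graph_space m = graph_space m'" "m \<noteq> m'"
    then show False
      using gg[of m m'] big[of "graph_space m"] by (simp add: spread_of_def)
  qed
  moreover have "infinity_space \<notin> graph_space ` N"
  proof
    assume "infinity_space \<in> graph_space ` N"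
    then obtain m where "m \<in> N" "infinity_space = graph_space m"
      by (elim imageE)
    then show False
      using ig[of m] big[of infinity_space] by (simp add: spread_of_def)
  qed
  moreover have "finite N"
    using NK finite_K by (meson finite_SigmaI finite_subset subsetI)
  ultimately show "card (spread_of N) = card N + 1"
    by (simp add: spread_of_def card_image)
qed

text \<open>A lagrangian \<open>W\<close> that meets \<open>infinity_space\<close> only in 0
  projects injectively to the first coordinate, hence onto it by counting, and is the graph of an
  additive map \<open>F\<close>. Isotropy of \<open>W\<close> makes \<open>F\<close> self-adjoint,
  and a vector where \<open>F\<close> agrees with a matrix of \<open>N\<close> lies in
  \<open>W\<close> and in a member.\<close>

lemma spread_of_maximal:
  assumes N: "nonsingular_differences N"
    and fixed: "\<And>F. (\<And>u. u \<in> K \<times> K \<Longrightarrow> F u \<in> K \<times> K) \<Longrightarrow>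
      (\<And>u w. u \<in> K \<times> K \<Longrightarrow> w \<in> K \<times> K \<Longrightarrow> F (u + w) = F u + F w) \<Longrightarrow>
      (\<And>u w. u \<in> K \<times> K \<Longrightarrow> w \<in> K \<times> K \<Longrightarrow> ip u (F w) = ip w (F u)) \<Longrightarrow>
      \<exists>m\<in>N. \<exists>u\<in>K \<times> K. u \<noteq> 0 \<and> F u = sym_map m u"
  shows "maximal_symplectic_partial_spread B (2 * k) (spread_of N)"
proof (rule maximal_symplectic_partial_spreadI[OF spread_of(1)[OF N]])
  fix W assume W: "totally_isotropic B W" "dim W = 2 * k"
  then have sW: "subspace W"
    by (simp add: totally_isotropic_def)
  show "\<exists>U\<in>spread_of N. W \<inter> U \<noteq> {0}"
  proof (rule ccontr)
    assume "\<not> (\<exists>U\<in>spread_of N. W \<inter> U \<noteq> {0})"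
    then have disj: "W \<inter> infinity_space = {0}" "\<And>m. m \<in> N \<Longrightarrow> W \<inter> graph_space m = {0}"
      by (auto simp: spread_of_def)
    have "\<exists>u w. u \<in> K \<times> K \<and> w \<in> K \<times> K \<and> v = \<alpha> u + \<beta> w" for v
      using coordinates_exist[of v] by blast
    then obtain a b where ab: "\<And>v. a v \<in> K \<times> K" "\<And>v. b v \<in> K \<times> K" "\<And>v. v = \<alpha> (a v) + \<beta> (b v)"
      by metis
    have ab_eq: "a (\<alpha> u + \<beta> w) = u" "b (\<alpha> u + \<beta> w) = w" if "u \<in> K \<times> K" "w \<in> K \<times> K" for u w
      using ab(3)[of "\<alpha> u + \<beta> w"] coordinates_eq[OF that ab(1,2)] by metis+
    have ab_add: "a (v + v') = a v + a v'" "b (v + v') = b v + b v'" for v v'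
    proof -
      have "v + v' = (\<alpha> (a v) + \<beta> (b v)) + (\<alpha> (a v') + \<beta> (b v'))"
        using ab(3) by metis
      also have "\<dots> = \<alpha> (a v + a v') + \<beta> (b v + b v')"
        using ab(1,2) by (simp add: \<alpha>_add \<beta>_add)
      finally show "a (v + v') = a v + a v'" "b (v + v') = b v + b v'"
        using ab_eq KK_add ab(1,2) by metis+
    qed
    have "inj_on a W"
    proof (rule inj_onI)
      fix v v' assume v: "v \<in> W" "v' \<in> W" "a v = a v'"
      have "a v + a v = 0"
        by (simp add: prod_eq_iff ac_add_self)
      then have "a (v + v') = 0"
        using v(3) by (simp add: ab_add)
      then have "v + v' = \<beta> (b (v + v'))"
        using ab(3)[of "v + v'"] by (simp only: \<alpha>\<beta>_0 add_0)
      then have "v + v' \<in> W \<inter> infinity_space"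
        using v sW subspace_add ab(2) by (metis IntI imageI infinity_space_def)
      then have "v + v' = 0"
        using disj(1) by blast
      moreover have "v' + v' = 0"
        using scale_left_distrib[of 1 1 v'] one_add_one_eq_0 by (simp only: scale_one scale_zero_left)
      ultimately show "v = v'"
        by (metis add_right_cancel)
    qed
    then have "card (a ` W) = card (K \<times> K)"
      using card_subspace[OF sW finite_space] W(2) by (simp only: card_image card_KK)
    then have surj: "a ` W = K \<times> K"
      using ab(1) finite_K by (intro card_subset_eq finite_cartesian_product image_subsetI)
    define F where "F u = b (inv_into W a u)" for u
    have mem: "\<alpha> u + \<beta> (F u) \<in> W" if "u \<in> K \<times> K" for u
    proof -
      have "inv_into W a u \<in> W" "a (inv_into W a u) = u"
        using that surj by (metis inv_into_into, metis f_inv_into_f)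
      then show ?thesis
        using ab(3)[of "inv_into W a u"] by (simp add: F_def)
    qed
    have F_eq: "F (a v) = b v" if "v \<in> W" for v
      using that \<open>inj_on a W\<close> by (simp add: F_def)
    have F: "F u \<in> K \<times> K" if "u \<in> K \<times> K" for u
      using ab(2) by (simp add: F_def)
    have "F (u + w) = F u + F w" if "u \<in> K \<times> K" "w \<in> K \<times> K" for u w
    proof -
      have "F (a ((\<alpha> u + \<beta> (F u)) + (\<alpha> w + \<beta> (F w)))) = b ((\<alpha> u + \<beta> (F u)) + (\<alpha> w + \<beta> (F w)))"
        by (intro F_eq subspace_add sW mem that)
      then show ?thesis
        by (simp only: ab_add[of "\<alpha> u + \<beta> (F u)"] ab_eq that F)
    qed
    moreover have "ip u (F w) = ip w (F u)" if "u \<in> K \<times> K" "w \<in> K \<times> K" for u w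
    proof -
      have "0 = B (\<alpha> u + \<beta> (F u)) (\<alpha> w + \<beta> (F w))"
        using W(1) that mem by (simp only: totally_isotropic_def)
      also have "\<dots> = ip u (F w) + ip w (F u)"
        using that F by (intro form_coordinates)
      finally have "ip u (F w) + ip w (F u) = ip w (F u) + ip w (F u)"
        by (simp only: add_self)
      then show ?thesis
        by simp
    qed
    ultimately obtain m u where mu: "m \<in> N" "u \<in> K \<times> K" "u \<noteq> 0" "F u = sym_map m u"
      using fixed[of F] F by blast
    then have "\<alpha> u + \<beta> (F u) \<in> graph_space m"
      unfolding graph_space_def by (intro image_eqI[of _ _ u]) simp_all
    with mem[OF mu(2)] have "\<alpha> u + \<beta> (F u) \<in> W \<inter> graph_space m"
      by blast
    then have "\<alpha> u + \<beta> (F u) = \<alpha> 0 + \<beta> 0"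
      using disj(2)[OF mu(1)] by (simp add: \<alpha>\<beta>_0)
    then show False
      using coordinates_eq[OF mu(2) F[OF mu(2)] KK_0 KK_0] mu(3) by simp
  qed
qed

text \<open>Self-adjointness makes \<open>f\<close> vanish on the polar form of the quadratic map,
  so a sign character composed with \<open>f\<close> is multiplicative along it, as
  \<open>quadratic_map_has_zero\<close> demands.\<close>

lemma self_adjoint_quadratic_zero:
  assumes F: "\<And>u. u \<in> K \<times> K \<Longrightarrow> F u \<in> K \<times> K"
      "\<And>u w. u \<in> K \<times> K \<Longrightarrow> w \<in> K \<times> K \<Longrightarrow> F (u + w) = F u + F w"
      "\<And>u w. u \<in> K \<times> K \<Longrightarrow> w \<in> K \<times> K \<Longrightarrow> ip u (F w) = ip w (F u)"
    and d: "d \<in> K"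
  shows "\<exists>u\<in>K \<times> K. u \<noteq> 0 \<and> fst u * fst (F u) + snd u * snd (F u) + d * (fst (F u))\<^sup>2 = 0"
proof -
  obtain \<mu> :: "'a \<Rightarrow> int" where \<mu>: "sign_character UNIV \<mu>" "\<mu> 1 = -1"
    using char_2_sign_character(2)[OF one_add_one_eq_0] by blast
  obtain e where e: "CARD('a) = 2 ^ e"
    using char_2_sign_character(1)[OF one_add_one_eq_0] by blast
  define g where "g u = fst u * fst (F u) + snd u * snd (F u) + d * (fst (F u))\<^sup>2" for u
  define h where "h u w = fst u * fst (F w) + snd u * snd (F w)" for u w
  have g_add: "g (u + w) = g u + g w + (h u w + h w u)" if "u \<in> K \<times> K" "w \<in> K \<times> K" for u w
  proof -
    \<comment> \<open>Squaring is additive, so the term with \<open>d\<close> contributes nothing to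
      the polar form.\<close>
    have "(fst (F u) + fst (F w))\<^sup>2 = (fst (F u))\<^sup>2 + (fst (F w))\<^sup>2
        + (fst (F u) * fst (F w) + fst (F u) * fst (F w))"
      by (simp add: power2_eq_square algebra_simps)
    then have "(fst (F u) + fst (F w))\<^sup>2 = (fst (F u))\<^sup>2 + (fst (F w))\<^sup>2"
      by (simp only: ac_add_self add_0_right)
    then show ?thesis
      using that by (simp add: g_def h_def F(2) algebra_simps)
  qed
  have polar_g: "polar_form g u w = h u w + h w u" if "u \<in> K \<times> K" "w \<in> K \<times> K" for u w
    using g_add[OF that] by (simp add: polar_form_def)
  have fg: "f (g (u + w)) = f (g u) + f (g w)" if "u \<in> K \<times> K" "w \<in> K \<times> K" for u w
  proof -
    have "f (g (u + w)) = f (g u) + f (g w) + (ip u (F w) + ip w (F u))"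
      using g_add[OF that] by (simp only: f_add ip_def h_def)
    also have "ip u (F w) + ip w (F u) = 0"
      using F(3)[OF that] by (simp only: add_self)
    finally show ?thesis
      by simp
  qed
  have F_coords: "fst (F u) \<in> K" "snd (F u) \<in> K" if "u \<in> K \<times> K" for u
    using F(1)[OF that] by auto
  have "\<exists>u\<in>K \<times> K. u \<noteq> 0 \<and> g u = 0"
  proof (rule quadratic_map_has_zero[where K = K and \<chi> = "\<lambda>x. \<mu> (f x)" and m = "e * k" and a = 1])
    show "card K = 2 ^ (e * k)"
      by (simp add: card_K e power_mult)
    show "card (K \<times> K) = 2 ^ (2 * (e * k))"
      unfolding card_KK e by (simp add: power_mult[symmetric] mult_ac)
    show "sign_character K (\<lambda>x. \<mu> (f x))"
      using \<mu>(1) by (auto simp: sign_character_def f_add)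
    show "g u \<in> K" if "u \<in> K \<times> K" for u
      using that F_coords[OF that] d by (auto simp: g_def)
    show "polar_form g (u + v) w = polar_form g u w + polar_form g v w"
      if "u \<in> K \<times> K" "v \<in> K \<times> K" "w \<in> K \<times> K" for u v w
      using that KK_add[OF that(1,2)]
      by (simp add: polar_g h_def F(2) algebra_simps)
    show "\<mu> (f (g (u + w))) = \<mu> (f (g u)) * \<mu> (f (g w))" if "u \<in> K \<times> K" "w \<in> K \<times> K" for u w
      using \<mu>(1) fg[OF that] by (simp add: sign_character_def)
    show "\<mu> (f 1) = - 1"
      by (simp add: f_1 \<mu>(2))
  qed (use KK_0 KK_add ac_add_self[of 1] in auto)
  then show ?thesis
    by (simp add: g_def)
qed

section \<open>The symplectic and orthogonal spread with \<open>q ^ k + 1\<close> members\<close>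

lemma exists_orthogonal_spread:
  "\<exists>Q S. plus_type Q \<and> polar_form Q = B \<and> maximal_symplectic_partial_spread B (2 * k) S \<and>
     maximal_orthogonal_partial_spread Q (2 * k) S \<and> card S = CARD('a) ^ k + 1"
proof -
  define N :: "('a alg_closure \<times> 'a alg_closure \<times> 'a alg_closure) set"
    where "N = (\<lambda>b. (0, b, 0)) ` K"
  have N: "nonsingular_differences N"
    by (auto simp: nonsingular_differences_def N_def ac_add_eq_0_iff)
  have "card N = CARD('a) ^ k"
    by (simp add: N_def card_image inj_on_def card_K)
  have max: "maximal_symplectic_partial_spread B (2 * k) (spread_of N)"
  proof (rule spread_of_maximal[OF N])
    fix F
    assume F: "\<And>u. u \<in> K \<times> K \<Longrightarrow> F u \<in> K \<times> K"
      "\<And>u w. u \<in> K \<times> K \<Longrightarrow> w \<in> K \<times> K \<Longrightarrow> F (u + w) = F u + F w"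
      "\<And>u w. u \<in> K \<times> K \<Longrightarrow> w \<in> K \<times> K \<Longrightarrow> ip u (F w) = ip w (F u)"
    from self_adjoint_quadratic_zero[of F 0] F obtain u
      where u: "u \<in> K \<times> K" "u \<noteq> 0" "fst u * fst (F u) + snd u * snd (F u) = 0"
      by auto
    obtain x y a c where xy: "u = (x, y)" "F (x, y) = (a, c)"
      by (metis surj_pair)
    then have Fu: "F u = (a, c)"
      by simp
    have K: "x \<in> K" "y \<in> K" "a \<in> K" "c \<in> K"
      using u(1) F(1)[OF u(1)] by (simp_all add: xy)
    have eq: "x * a = y * c"
      using u(3) by (simp add: xy ac_add_eq_0_iff)
    \<comment> \<open>The matrix of \<open>(0, b, 0)\<close> sends \<open>(x, y)\<close> to
      \<open>(b * y, b * x)\<close>, so \<open>b\<close> has to satisfy \<open>a = b * y\<close> and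
      \<open>c = b * x\<close>. These are compatible because \<open>x * a = y * c\<close>.\<close>
    show "\<exists>m\<in>N. \<exists>u\<in>K \<times> K. u \<noteq> 0 \<and> F u = sym_map m u"
    proof (cases "y = 0")
      case True
      then have "x \<noteq> 0" "a = 0"
        using u(2) eq by (auto simp: xy zero_prod_def)
      then have "F u = sym_map (0, c / x, 0) u"
        unfolding Fu using True by (simp add: xy(1))
      moreover have "(0, c / x, 0) \<in> N"
        using K by (simp add: N_def)
      ultimately show ?thesis
        using u(1,2) by blast
    next
      case False
      then have "F u = sym_map (0, a / y, 0) u"
        unfolding Fu using eq by (simp add: xy(1) field_simps)
      moreover have "(0, a / y, 0) \<in> N"
        using K by (simp add: N_def)
      ultimately show ?thesis
        using u(1,2) by blast
    qed
  qed
  \<comment> \<open>\<open>Q\<close> is chosen pointwise as \<open>ip u w\<close>; uniqueness of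
    coordinates makes the value independent of the choice.\<close>
  have "\<exists>q. \<exists>u\<in>K \<times> K. \<exists>w\<in>K \<times> K. v = \<alpha> u + \<beta> w \<and> q = ip u w" for v
    using coordinates_exist[of v] by blast
  then obtain Q where Q0: "\<And>v. \<exists>u\<in>K \<times> K. \<exists>w\<in>K \<times> K. v = \<alpha> u + \<beta> w \<and> Q v = ip u w"
    by metis
  have Q: "Q (\<alpha> u + \<beta> w) = ip u w" if "u \<in> K \<times> K" "w \<in> K \<times> K" for u w
    using Q0[of "\<alpha> u + \<beta> w"] coordinates_eq that by metis
  have polar: "polar_form Q v v' = B v v'" for v v'
  proof -
    obtain u w u' w' where uw: "u \<in> K \<times> K" "w \<in> K \<times> K" "u' \<in> K \<times> K" "w' \<in> K \<times> K"
      "v = \<alpha> u + \<beta> w" "v' = \<alpha> u' + \<beta> w'"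
      using coordinates_exist by meson
    have "v + v' = \<alpha> (u + u') + \<beta> (w + w')"
      using uw by (simp add: \<alpha>_add \<beta>_add)
    then have "Q (v + v') = ip (u + u') (w + w')"
      using uw by (simp only: Q KK_add)
    then show ?thesis
      using uw by (simp add: polar_form_def Q form_coordinates ip_simps(1,2))
  qed
  then have polar': "polar_form Q = B"
    by blast
  have Q_scale: "Q (scale c v) = c\<^sup>2 * Q v" for c v
  proof -
    obtain u w where uw: "u \<in> K \<times> K" "w \<in> K \<times> K" "v = \<alpha> u + \<beta> w"
      using coordinates_exist by meson
    let ?s = "\<lambda>u. (to_ac c * fst u, to_ac c * snd u)"
    have "?s u \<in> K \<times> K" "?s w \<in> K \<times> K"
      using uw by auto
    then have "Q (\<alpha> (?s u) + \<beta> (?s w)) = ip (?s u) (?s w)"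
      by (rule Q)
    moreover have "ip (?s u) (?s w) = f (to_ac c * (to_ac c * (fst u * fst w + snd u * snd w)))"
      by (simp add: ip_def algebra_simps)
    ultimately show ?thesis
      using uw by (simp add: \<alpha>_scale \<beta>_scale scale_right_distrib Q f_scale ip_def power2_eq_square)
  qed
  have f0: "f 0 = 0"
    using f_scale[of 0 0] by simp
  have "Q v = 0" if v: "v \<in> infinity_space" for v
  proof -
    obtain w where "w \<in> K \<times> K" "v = \<alpha> 0 + \<beta> w"
      using v by (auto simp: infinity_space_def \<alpha>\<beta>_0)
    then show ?thesis
      using Q[OF KK_0] by (simp add: ip_def f0)
  qed
  \<comment> \<open>On such a graph \<open>Q\<close> is \<open>f\<close> of a sum of two equal
    products.\<close>
  moreover have "Q v = 0" if v: "v \<in> graph_space (0, b, 0)" and b: "b \<in> K" for v b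
  proof -
    obtain u where u: "u \<in> K \<times> K" "v = \<alpha> u + \<beta> (sym_map (0, b, 0) u)"
      using v by (auto simp: graph_space_def)
    then have "Q v = ip u (sym_map (0, b, 0) u)"
      using b by (simp add: Q sym_map_simps(1))
    also have "\<dots> = f (b * (fst u * snd u) + b * (fst u * snd u))"
      by (cases u) (simp add: ip_def algebra_simps)
    also have "\<dots> = 0"
      by (simp only: ac_add_self f0)
    finally show ?thesis .
  qed
  ultimately have singular: "totally_singular Q W" if "W \<in> spread_of N" for W
    using that spread_of(1)[OF N]
    by (auto simp: totally_singular_def spread_of_def N_def symplectic_partial_spread_def
        totally_isotropic_def)
  have "infinity_space \<in> spread_of N"
    by (simp add: spread_of_def)
  then have "plus_type Q"
    using singular[of infinity_space] infinity_space_isotropic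
    by (intro plus_typeI[OF polar' Q_scale, of infinity_space])
      (auto simp: totally_isotropic_def intro: dim_eq_if_card)
  then show ?thesis
    using polar' max maximal_orthogonal_if_maximal_symplectic[OF max polar' singular]
      spread_of(2)[OF N] \<open>card N = _\<close> by auto
qed

section \<open>The symplectic spread with \<open>2 * q ^ k + 1\<close> members\<close>

lemma exists_large_symplectic_spread:
  "\<exists>S. maximal_symplectic_partial_spread B (2 * k) S \<and> card S = 2 * CARD('a) ^ k + 1"
proof -
  define N :: "('a alg_closure \<times> 'a alg_closure \<times> 'a alg_closure) set"
    where "N = (\<lambda>(e, b). (e, b, b\<^sup>2 + e)) ` ({0, 1} \<times> K)"
  have sq: "(b + c)\<^sup>2 = b\<^sup>2 + c\<^sup>2" for b c :: "'a alg_closure"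
  proof -
    have "(b + c)\<^sup>2 = b\<^sup>2 + c\<^sup>2 + (b * c + b * c)"
      by (simp add: power2_eq_square algebra_simps)
    then show ?thesis
      by (simp only: ac_add_self add_0_right)
  qed
  have N: "nonsingular_differences N"
    unfolding nonsingular_differences_def
  proof (intro conjI allI impI)
    show "N \<subseteq> K \<times> K \<times> K"
      by (auto simp: N_def)
    fix p r s p' r' s'
    assume *: "(p, r, s) \<in> N" "(p', r', s') \<in> N" "(p, r, s) \<noteq> (p', r', s')"
    then have ps: "p \<in> {0, 1}" "p' \<in> {0, 1}" "s = r\<^sup>2 + p" "s' = r'\<^sup>2 + p'"
      by (auto simp: N_def)
    \<comment> \<open>For \<open>p = p'\<close> the left side is 0 while
      \<open>r \<noteq> r'\<close>. Otherwise \<open>p + p' = 1\<close>, and the left side is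
      \<open>(r + r')\<^sup>2 + 1\<close>.\<close>
    show "(p + p') * (s + s') \<noteq> (r + r')\<^sup>2"
    proof (cases "p = p'")
      case True
      then have "r \<noteq> r'"
        using *(3) ps by auto
      then show ?thesis
        using True by (simp add: ac_add_self ac_add_eq_0_iff)
    next
      case False
      then have "p + p' = 1"
        using ps by auto
      moreover have "s + s' = (r + r')\<^sup>2 + (p + p')"
        by (simp add: ps sq)
      ultimately show ?thesis
        by simp
    qed
  qed
  have "inj_on (\<lambda>(e, b). (e, b, b\<^sup>2 + e)) ({0, 1} \<times> K)"
    by (auto simp: inj_on_def)
  then have "card N = 2 * CARD('a) ^ k"
    by (simp add: N_def card_image card_cartesian_product card_K)
  have "maximal_symplectic_partial_spread B (2 * k) (spread_of N)"
  proof (rule spread_of_maximal[OF N])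
    fix F
    assume F: "\<And>u. u \<in> K \<times> K \<Longrightarrow> F u \<in> K \<times> K"
      "\<And>u w. u \<in> K \<times> K \<Longrightarrow> w \<in> K \<times> K \<Longrightarrow> F (u + w) = F u + F w"
      "\<And>u w. u \<in> K \<times> K \<Longrightarrow> w \<in> K \<times> K \<Longrightarrow> ip u (F w) = ip w (F u)"
    from self_adjoint_quadratic_zero[of F 1] F obtain u
      where u: "u \<in> K \<times> K" "u \<noteq> 0" "fst u * fst (F u) + snd u * snd (F u) + (fst (F u))\<^sup>2 = 0"
      by auto
    obtain x y a c where xy: "u = (x, y)" "F (x, y) = (a, c)"
      by (metis surj_pair)
    then have Fu: "F u = (a, c)"
      by simp
    have K: "x \<in> K" "y \<in> K" "a \<in> K" "c \<in> K"
      using u(1) F(1)[OF u(1)] by (simp_all add: xy)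
    have "x * a + a\<^sup>2 + y * c = 0"
      using u(3) by (simp add: xy add_ac)
    then have eq: "x * a + a\<^sup>2 = y * c"
      by (simp only: ac_add_eq_0_iff)
    have "\<exists>e\<in>{0, 1}. \<exists>b\<in>K. F u = sym_map (e, b, b\<^sup>2 + e) u"
    \<comment> \<open>For \<open>y = 0\<close> the matrix sends \<open>(x, 0)\<close> to
      \<open>(e * x, b * x)\<close>, and the equation forces \<open>a / x\<close> to be 0 or 1, an
      admissible \<open>e\<close>. For \<open>y \<noteq> 0\<close> the choice \<open>e = 0\<close>,
      \<open>b = a / y\<close> fits the first coordinate, and the equation is what the second one
      requires.\<close>
    proof (cases "y = 0")
      case True
      then have "x \<noteq> 0"
        using u(2) by (auto simp: xy zero_prod_def)
      have "(x + a) * a = 0"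
        using eq True by (simp add: power2_eq_square distrib_right)
      then have "a = 0 \<or> a = x"
        by (auto simp: ac_add_eq_0_iff)
      then have "\<exists>b\<in>K. F u = sym_map (a / x, b, b\<^sup>2 + a / x) u" "a / x \<in> {0, 1}"
        unfolding Fu using \<open>x \<noteq> 0\<close> True K by (auto simp: xy(1) intro!: bexI[of _ "c / x"])
      then show ?thesis
        by blast
    next
      case False
      then have "F u = sym_map (0, a / y, (a / y)\<^sup>2 + 0) u"
        unfolding Fu using eq by (simp add: xy(1) field_simps power2_eq_square)
      moreover have "a / y \<in> K"
        using K by simp
      ultimately show ?thesis
        by blast
    qed
    then obtain e b where "e \<in> {0, 1}" "b \<in> K" "F u = sym_map (e, b, b\<^sup>2 + e) u"
      by blast
    moreover from this have "(e, b, b\<^sup>2 + e) \<in> N"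
      unfolding N_def by (intro image_eqI[of _ _ "(e, b)"]) simp_all
    ultimately show "\<exists>m\<in>N. \<exists>u\<in>K \<times> K. u \<noteq> 0 \<and> F u = sym_map m u"
      using u(1,2) by blast
  qed
  then show ?thesis
    using spread_of(2)[OF N] \<open>card N = _\<close> by auto
qed

end

section \<open>Existence of the coordinates, and both spreads together\<close>

text \<open>\<open>K \<times> K\<close> has the order of a lagrangian. Its form \<open>ip\<close> is
  nondegenerate: pairing \<open>w\<close> with the inverse of a nonzero coordinate, placed in the
  same position, gives \<open>f 1 = 1\<close>.\<close>

lemma (in char_2_sp_space) exists_ext_field_coordinates:
  assumes "n = 2 * k" "k \<ge> 1"
  shows "\<exists>f \<alpha> \<beta> K ip. ext_field_coordinates scale B k f \<alpha> \<beta> K ip"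
proof -
  define K :: "'a alg_closure set" where "K = ext_field k"
  obtain f :: "'a alg_closure \<Rightarrow> 'a"
    where f_add: "\<And>x y. f (x + y) = f x + f y" and f_scale: "\<And>c x. f (to_ac c * x) = c * f x"
      and f_1: "f 1 = 1"
    using exists_ac_functional by blast
  define sM where "sM c u = (to_ac c * fst u, to_ac c * snd u)"
    for c :: 'a and u :: "'a alg_closure \<times> 'a alg_closure"
  define ip where "ip u w = f (fst u * fst w + snd u * snd w)"
    for u w :: "'a alg_closure \<times> 'a alg_closure"
  have vs: "vector_space sM"
    by unfold_locales (rule prod_eqI; simp add: sM_def distrib_left distrib_right mult.assoc)+
  then interpret m: vector_space sM .
  have sub: "m.subspace (K \<times> K)"
    by (auto simp: m.subspace_def sM_def K_def ext_field_basic ext_field_add[OF one_add_one_eq_0]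
        zero_prod_def plus_prod_def)
  have card: "card (K \<times> K) = CARD('a) ^ n"
    using card_ext_field[OF one_add_one_eq_0 assms(2)]
    by (simp add: card_cartesian_product K_def assms(1) mult_2 power_add)
  have ip: "ip (u + v) w = ip u w + ip v w" "ip u (v + w) = ip u v + ip u w"
    "ip (sM c u) w = c * ip u w" "ip u (sM c w) = c * ip u w" for u v w c
    unfolding ip_def f_add[symmetric] f_scale[symmetric] by (simp_all add: sM_def algebra_simps)
  have nondeg: "\<exists>u\<in>K \<times> K. ip u w \<noteq> 0" if w: "w \<in> K \<times> K" "w \<noteq> 0" for w
  proof (cases "fst w = 0")
    case True
    then have "snd w \<noteq> 0"
      using w(2) by (auto simp: prod_eq_iff)
    then show ?thesis
      using w(1) f_1 by (intro bexI[of _ "(0, inverse (snd w))"])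
        (auto simp: ip_def K_def ext_field_basic)
  next
    case False
    then show ?thesis
      using w(1) f_1 by (intro bexI[of _ "(inverse (fst w), 0)"])
        (auto simp: ip_def K_def ext_field_basic)
  qed
  obtain \<alpha> \<beta> where
    "\<forall>u\<in>K \<times> K. \<forall>w\<in>K \<times> K. \<alpha> (u + w) = \<alpha> u + \<alpha> w \<and> \<beta> (u + w) = \<beta> u + \<beta> w"
    "\<forall>c. \<forall>u\<in>K \<times> K. \<alpha> (sM c u) = scale c (\<alpha> u) \<and> \<beta> (sM c u) = scale c (\<beta> u)"
    "\<forall>u\<in>K \<times> K. \<forall>w\<in>K \<times> K. B (\<alpha> u) (\<alpha> w) = 0 \<and> B (\<beta> u) (\<beta> w) = 0 \<and> B (\<alpha> u) (\<beta> w) = ip u w"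
    "bij_betw (\<lambda>(u, w). \<alpha> u + \<beta> w) ((K \<times> K) \<times> (K \<times> K)) UNIV"
    using exists_hyperbolic_coordinates[OF vs sub card ip nondeg] by blast
  moreover have "char_2_sp_space scale B (2 * k)"
    using char_2_sp_space_axioms assms(1) by simp
  ultimately have "ext_field_coordinates scale B k f \<alpha> \<beta> K ip"
    using assms(2) f_1
    by (intro ext_field_coordinates.intro ext_field_coordinates_axioms.intro)
      (auto simp: sM_def K_def ip_def f_add f_scale)
  then show ?thesis
    by blast
qed

theorem theorem5p2:
  fixes scale :: "'a::{field,finite} \<Rightarrow> 'b::ab_group_add \<Rightarrow> 'b"
    and B :: "'b \<Rightarrow> 'b \<Rightarrow> 'a"
    and k :: nat
  assumes "even CARD('a)"
    and "k \<ge> 1"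
    and "sp_space scale B (2 * k)"
  shows "(\<exists>Q S. fq_space.plus_type scale Q
            \<and> polar_form Q = B
            \<and> fq_space.maximal_symplectic_partial_spread scale B (2 * k) S
            \<and> fq_space.maximal_orthogonal_partial_spread scale Q (2 * k) S
            \<and> card S = CARD('a) ^ k + 1)
       \<and> (\<exists>S. fq_space.maximal_symplectic_partial_spread scale B (2 * k) S
            \<and> card S = 2 * CARD('a) ^ k + 1)"
proof -
  interpret char_2_sp_space scale B "2 * k"
    using assms(1,3) char_2_if_even_card
    by (simp add: char_2_sp_space_def char_2_sp_space_axioms_def)
  obtain f \<alpha> \<beta> K ip where "ext_field_coordinates scale B k f \<alpha> \<beta> K ip"
    using exists_ext_field_coordinates[OF refl assms(2)] by blast
  then interpret ext_field_coordinates scale B k f \<alpha> \<beta> K ip .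
  show ?thesis
    using exists_orthogonal_spread exists_large_symplectic_spread by blast
qed

end
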